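(* Let $\omega\in C([0,T];\mathbb{R}^d)$ have finite quadratic variation along the sequence of partitions $\pi=(\pi_n)_{n\ge1}$ of $[0,T]$ (i.e. $\omega\in Q_\pi([0,T];\mathbb{R}^d)$), suppose $\mathrm{osc}(\omega,\pi_n)\to0$ as $n\to\infty$, and let $F\in\mathcal{W}^2_{\omega,\pi}$. Let $(F_m)_{m\ge1}\subset C^2_b(\mathbb{R}^d)\cap W^{2,1}(\mathbb{R}^d)$ be any sequence such that $$F_m(\omega(t))\to F(\omega(t))\ \text{ for all } t\in[0,T],\qquad \|\nabla^2F_m-\nabla^2F\|_{\mathcal{W}^0_{\omega,\pi}}\to0\quad (m\to\infty).$$ Then for every $t\in[0,T]$ the limits $$\int_0^t\nabla F(\omega(s))\,d^\pi\omega(s):=\lim_{m\to\infty}\int_0^t\nabla F_m(\omega(s))\,d^\pi\omega(s),\qquad [\nabla F(\omega),\omega]_\pi(t):=\lim_{m\to\infty}[\nabla F_m(\omega),\omega]_\pi(t)$$ exist and are independent of the choice of the sequence $(F_m)_{m\ge1}$ satisfying the two convergence conditions above. Moreover, with these definitions, for every $t\in[0,T]$, $$F(\omega(t))-F(\omega(0))=\int_0^t\nabla F(\omega(s))\,d^\pi\omega(s)+\frac12[\nabla F(\omega),\omega]_\pi(t).$$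
   Context: Fix $T>0$, $d\ge1$ and a sequence $\pi=(\pi_n)_{n\ge1}$ of partitions $\pi_n=\{0=t^n_0<t^n_1<\dots<t^n_{m(n)}=T\}$ of $[0,T]$. Quadratic variation. A path $x\in C([0,T],\mathbb{R})$ has finite quadratic variation along $\pi$ if for all $t\in[0,T]$ the limit $[x]_\pi(t)=\lim_{n}\sum_{t^n_{i+1}\le t}(x(t^n_{i+1})-x(t^n_i))^2<\infty$ exists and $t\mapsto[x]_\pi(t)$ is continuous and increasing; the set of such paths is $Q_\pi([0,T],\mathbb{R})$. A path $x=(x^1,\dots,x^d)\in C([0,T],\mathbb{R}^d)$ belongs to $Q_\pi([0,T],\mathbb{R}^d)$ if $x^i\in Q_\pi([0,T],\mathbb{R})$ and $x^i+x^j\in Q_\pi([0,T],\mathbb{R})$ for all $i,j$. Oscillation: $\mathrm{osc}(\omega,\pi_n):=\max_{0\le i\le m(n)-1}\sup_{t\in[t^n_i,t^n_{i+1}]}|\omega(t)-\omega(t^n_i)|$. Discrete weighted occupation densities. For $x\in\mathbb{R}^d$, $$\mathcal{L}^{\pi_n}_\omega(x):=\sum_{i=0}^{m(n)-1}\mathcal{L}^{n,i}_\omega(x),\quad \mathcal{L}^{n,i}_\omega(x):=c_d\left(\frac1{|x-\omega(t^n_i)|^{d-2}}+\frac1{|x-\omega(t^n_{i+1})|^{d-2}}\right)1_{Q^n_i}(x),$$ where $Q^n_i$ is the closed ball with center $\frac12(\omega(t^n_i)+\omega(t^n_{i+1}))$ and radius $\frac12|\omega(t^n_{i+1})-\omega(t^n_i)|$,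 $c_d=2/|B(0,1)|$ (with $|B(0,1)|$ the Lebesgue measure of the unit ball), and $\mathcal{L}^{n,i}_\omega\equiv0$ if $\omega(t^n_{i+1})=\omega(t^n_i)$. (The constant is such that $\int\mathcal{L}^{n,i}_\omega\,dx=|\omega(t^n_{i+1})-\omega(t^n_i)|^2$.) Seminorm: for a (scalar- or matrix-valued) measurable $f$, $\|f\|_{\mathcal{W}^0_{\omega,\pi}}:=\limsup_{n\to\infty}\int_{\mathbb{R}^d}|f(x)|\,\mathcal{L}^{\pi_n}_\omega(x)\,dx\in[0,\infty]$. Space: $\mathcal{W}^2_{\omega,\pi}$ is the set of $F\in W^{2,1}(\mathbb{R}^d)$ (real-valued) for which there exists a sequence $(F_m)_{m\ge1}\subset C^2_b(\mathbb{R}^d)\cap W^{2,1}(\mathbb{R}^d)$ with $F_m(\omega(t))\to F(\omega(t))$ in $\mathbb{R}$ for all $t\in[0,T]$ and $\|\nabla^2F_m-\nabla^2F\|_{\mathcal{W}^0_{\omega,\pi}}\to0$. Here $\nabla^2F$ is the weak Hessian, and pointwise values of a Sobolev function are those of the representative $F(x)=\limsup_{r\to0}\frac1{|B(x,r)|}\int_{B(x,r)}F(y)\,dy$. $C^2_b$ denotes $C^2$ functions which are bounded together with their derivatives up to order 2. For $f\in C^2_b(\mathbb{R}^d)$ the following limits exist and define the left-hand sides: $$\int_0^t\nabla f(\omega(s))\,d^\pi\omega(s):=\lim_{n\to\infty}\sum_{k=0}^{m(n)-1}\nabla f(\omega(t^n_k))\cdot(\omega(t^n_{k+1}\wedge t)-\omega(t^n_k\wedge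 t)),$$ $$[\nabla f(\omega),\omega]_\pi(t):=\lim_{n\to\infty}\sum_{k=0}^{m(n)-1}\big(\nabla f(\omega(t^n_{k+1}\wedge t))-\nabla f(\omega(t^n_k\wedge t))\big)\cdot(\omega(t^n_{k+1}\wedge t)-\omega(t^n_k\wedge t)).$$ *)

theory Defs
  imports "HOL-Analysis.Analysis"
begin

section \<open>Partitions, quadratic variation, oscillation\<close>

text \<open>A sequence of partitions is given by \<open>m\<close> and \<open>\<tau>\<close>: the partition number \<open>n\<close> consists of
  the points \<open>\<tau> n 0 < \<dots> < \<tau> n (m n)\<close>. Paths are functions on \<open>real\<close> of which only the values on
  \<open>{0..T}\<close> matter.\<close>

definition is_partition_seq :: "real \<Rightarrow> (nat \<Rightarrow> nat) \<Rightarrow> (nat \<Rightarrow> nat \<Rightarrow> real) \<Rightarrow> bool" where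
  "is_partition_seq T m \<tau> \<longleftrightarrow>
     (\<forall>n. \<tau> n 0 = 0 \<and> \<tau> n (m n) = T \<and> (\<forall>i<m n. \<tau> n i < \<tau> n (Suc i)))"

definition scalar_Q :: "real \<Rightarrow> (nat \<Rightarrow> nat) \<Rightarrow> (nat \<Rightarrow> nat \<Rightarrow> real) \<Rightarrow> (real \<Rightarrow> real) \<Rightarrow> bool" where
  "scalar_Q T m \<tau> x \<longleftrightarrow> continuous_on {0..T} x \<and>
     (\<exists>q. (\<forall>t\<in>{0..T}.
            (\<lambda>n. \<Sum>i | i < m n \<and> \<tau> n (Suc i) \<le> t. (x (\<tau> n (Suc i)) - x (\<tau> n i))\<^sup>2) \<longlonglongrightarrow> q t)
        \<and> continuous_on {0..T} q \<and> mono_on {0..T} q)"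

definition vector_Q ::
  "real \<Rightarrow> (nat \<Rightarrow> nat) \<Rightarrow> (nat \<Rightarrow> nat \<Rightarrow> real) \<Rightarrow> (real \<Rightarrow> real ^ 'd) \<Rightarrow> bool" where
  "vector_Q T m \<tau> \<omega> \<longleftrightarrow> continuous_on {0..T} \<omega> \<and>
     (\<forall>i. scalar_Q T m \<tau> (\<lambda>t. \<omega> t $ i)) \<and>
     (\<forall>i j. scalar_Q T m \<tau> (\<lambda>t. \<omega> t $ i + \<omega> t $ j))"

definition osc ::
  "(nat \<Rightarrow> nat) \<Rightarrow> (nat \<Rightarrow> nat \<Rightarrow> real) \<Rightarrow> (real \<Rightarrow> real ^ 'd) \<Rightarrow> nat \<Rightarrow> real" where
  "osc m \<tau> \<omega> n = (MAX i\<in>{..<m n}. SUP t\<in>{\<tau> n i..\<tau> n (Suc i)}. norm (\<omega> t - \<omega> (\<tau> n i)))"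

section \<open>Discrete weighted occupation densities\<close>

text \<open>The exponent \<open>d - 2\<close> is the integer \<open>-1\<close> for \<open>d = 1\<close>, hence \<open>powi\<close>. For \<open>d \<ge> 3\<close> the
  value at the two singular points \<open>a\<close>, \<open>b\<close> is affected by \<open>1 / 0 = 0\<close>; the density is only ever
  integrated against Lebesgue measure.\<close>

definition segment_density :: "real ^ 'd \<Rightarrow> real ^ 'd \<Rightarrow> real ^ 'd \<Rightarrow> real" where
  "segment_density a b x =
     (if a = b then 0
      else 2 / measure lebesgue (ball (0 :: real ^ 'd) 1)
           * (1 / norm (x - a) powi (int CARD('d) - 2) + 1 / norm (x - b) powi (int CARD('d) - 2))
           * indicator (cball ((1/2) *\<^sub>R (a + b)) ((1/2) * norm (b - a))) x)"

definition occ_density ::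
  "(nat \<Rightarrow> nat) \<Rightarrow> (nat \<Rightarrow> nat \<Rightarrow> real) \<Rightarrow> (real \<Rightarrow> real ^ 'd) \<Rightarrow> nat \<Rightarrow> real ^ 'd \<Rightarrow> real" where
  "occ_density m \<tau> \<omega> n x = (\<Sum>i<m n. segment_density (\<omega> (\<tau> n i)) (\<omega> (\<tau> n (Suc i))) x)"

text \<open>For matrix-valued \<open>f\<close>, the norm of \<open>real ^ 'd ^ 'd\<close> is the Frobenius norm.\<close>

definition W0_norm ::
  "(nat \<Rightarrow> nat) \<Rightarrow> (nat \<Rightarrow> nat \<Rightarrow> real) \<Rightarrow> (real \<Rightarrow> real ^ 'd)
     \<Rightarrow> (real ^ 'd \<Rightarrow> 'b::real_normed_vector) \<Rightarrow> ennreal" where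
  "W0_norm m \<tau> \<omega> f =
     limsup (\<lambda>n. \<integral>\<^sup>+ x. ennreal (norm (f x) * occ_density m \<tau> \<omega> n x) \<partial>lebesgue)"

section \<open>Differentiable functions and Sobolev functions\<close>

definition grad :: "(real ^ 'd \<Rightarrow> real) \<Rightarrow> real ^ 'd \<Rightarrow> real ^ 'd" where
  "grad f x = (\<chi> i. frechet_derivative f (at x) (axis i 1))"

definition hess :: "(real ^ 'd \<Rightarrow> real) \<Rightarrow> real ^ 'd \<Rightarrow> real ^ 'd ^ 'd" where
  "hess f x = (\<chi> i. grad (\<lambda>y. grad f y $ i) x)"

primrec C_k :: "nat \<Rightarrow> (real ^ 'd \<Rightarrow> real) \<Rightarrow> bool" where
  "C_k 0 f \<longleftrightarrow> continuous_on UNIV f"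
| "C_k (Suc k) f \<longleftrightarrow> (\<forall>x. f differentiable (at x)) \<and> (\<forall>i. C_k k (\<lambda>x. grad f x $ i))"

definition C2_b :: "(real ^ 'd \<Rightarrow> real) \<Rightarrow> bool" where
  "C2_b f \<longleftrightarrow> C_k 2 f \<and> bounded (range f) \<and> bounded (range (grad f)) \<and> bounded (range (hess f))"

definition test_function :: "(real ^ 'd \<Rightarrow> real) \<Rightarrow> bool" where
  "test_function \<phi> \<longleftrightarrow> (\<forall>k. C_k k \<phi>) \<and> compact (closure {x. \<phi> x \<noteq> 0})"

definition has_weak_grad :: "(real ^ 'd \<Rightarrow> real) \<Rightarrow> (real ^ 'd \<Rightarrow> real ^ 'd) \<Rightarrow> bool" where
  "has_weak_grad F G \<longleftrightarrow> (\<forall>\<phi> i. test_function \<phi> \<longrightarrow>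
     (\<integral>x. F x * grad \<phi> x $ i \<partial>lebesgue) = - (\<integral>x. G x $ i * \<phi> x \<partial>lebesgue))"

definition has_weak_hess :: "(real ^ 'd \<Rightarrow> real) \<Rightarrow> (real ^ 'd \<Rightarrow> real ^ 'd ^ 'd) \<Rightarrow> bool" where
  "has_weak_hess F H \<longleftrightarrow> (\<forall>\<phi> i j. test_function \<phi> \<longrightarrow>
     (\<integral>x. F x * hess \<phi> x $ i $ j \<partial>lebesgue) = (\<integral>x. H x $ i $ j * \<phi> x \<partial>lebesgue))"

definition sobolev_W21 :: "(real ^ 'd \<Rightarrow> real) \<Rightarrow> bool" where
  "sobolev_W21 F \<longleftrightarrow> integrable lebesgue F \<and>
     (\<exists>G. integrable lebesgue G \<and> has_weak_grad F G) \<and>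
     (\<exists>H. integrable lebesgue H \<and> has_weak_hess F H)"

text \<open>The weak Hessian is determined only up to Lebesgue null sets.\<close>

definition weak_hess :: "(real ^ 'd \<Rightarrow> real) \<Rightarrow> real ^ 'd \<Rightarrow> real ^ 'd ^ 'd" where
  "weak_hess F = (SOME H. integrable lebesgue H \<and> has_weak_hess F H)"

text \<open>The upper limit of the averages may be infinite. It depends only on the
  almost-everywhere class of \<open>F\<close>.\<close>

definition precise_rep :: "(real ^ 'd \<Rightarrow> real) \<Rightarrow> real ^ 'd \<Rightarrow> ereal" where
  "precise_rep F x = Limsup (at_right 0)
     (\<lambda>r. ereal ((LINT y:ball x r|lebesgue. F y) / measure lebesgue (ball x r)))"

section \<open>The space of admissible functions\<close>

text \<open>Convergence at \<open>\<omega> t\<close> takes place in the reals, so \<open>precise_rep F (\<omega> t)\<close> is required to be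
  finite.\<close>

definition W2_approx ::
  "real \<Rightarrow> (nat \<Rightarrow> nat) \<Rightarrow> (nat \<Rightarrow> nat \<Rightarrow> real) \<Rightarrow> (real \<Rightarrow> real ^ 'd)
     \<Rightarrow> (real ^ 'd \<Rightarrow> real) \<Rightarrow> (nat \<Rightarrow> real ^ 'd \<Rightarrow> real) \<Rightarrow> bool" where
  "W2_approx T m \<tau> \<omega> F Fs \<longleftrightarrow>
     (\<forall>k. C2_b (Fs k) \<and> sobolev_W21 (Fs k)) \<and>
     (\<forall>t\<in>{0..T}. \<bar>precise_rep F (\<omega> t)\<bar> \<noteq> \<infinity> \<and>
        (\<lambda>k. Fs k (\<omega> t)) \<longlonglongrightarrow> real_of_ereal (precise_rep F (\<omega> t))) \<and>
     (\<lambda>k. W0_norm m \<tau> \<omega> (\<lambda>x. hess (Fs k) x - weak_hess F x)) \<longlonglongrightarrow> 0"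

definition W2_space ::
  "real \<Rightarrow> (nat \<Rightarrow> nat) \<Rightarrow> (nat \<Rightarrow> nat \<Rightarrow> real) \<Rightarrow> (real \<Rightarrow> real ^ 'd) \<Rightarrow> (real ^ 'd \<Rightarrow> real) set" where
  "W2_space T m \<tau> \<omega> = {F. sobolev_W21 F \<and> (\<exists>Fs. W2_approx T m \<tau> \<omega> F Fs)}"

section \<open>Pathwise integral and covariation for smooth integrands\<close>

definition integral_sum ::
  "(nat \<Rightarrow> nat) \<Rightarrow> (nat \<Rightarrow> nat \<Rightarrow> real) \<Rightarrow> (real \<Rightarrow> real ^ 'd)
     \<Rightarrow> (real ^ 'd \<Rightarrow> real) \<Rightarrow> real \<Rightarrow> nat \<Rightarrow> real" where
  "integral_sum m \<tau> \<omega> f t n =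
     (\<Sum>k<m n. grad f (\<omega> (\<tau> n k)) \<bullet> (\<omega> (min (\<tau> n (Suc k)) t) - \<omega> (min (\<tau> n k) t)))"

definition covariation_sum ::
  "(nat \<Rightarrow> nat) \<Rightarrow> (nat \<Rightarrow> nat \<Rightarrow> real) \<Rightarrow> (real \<Rightarrow> real ^ 'd)
     \<Rightarrow> (real ^ 'd \<Rightarrow> real) \<Rightarrow> real \<Rightarrow> nat \<Rightarrow> real" where
  "covariation_sum m \<tau> \<omega> f t n =
     (\<Sum>k<m n. (grad f (\<omega> (min (\<tau> n (Suc k)) t)) - grad f (\<omega> (min (\<tau> n k) t)))
               \<bullet> (\<omega> (min (\<tau> n (Suc k)) t) - \<omega> (min (\<tau> n k) t)))"

definition pathwise_integral ::
  "(nat \<Rightarrow> nat) \<Rightarrow> (nat \<Rightarrow> nat \<Rightarrow> real) \<Rightarrow> (real \<Rightarrow> real ^ 'd)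
     \<Rightarrow> (real ^ 'd \<Rightarrow> real) \<Rightarrow> real \<Rightarrow> real" where
  "pathwise_integral m \<tau> \<omega> f t = lim (integral_sum m \<tau> \<omega> f t)"

definition pathwise_covariation ::
  "(nat \<Rightarrow> nat) \<Rightarrow> (nat \<Rightarrow> nat \<Rightarrow> real) \<Rightarrow> (real \<Rightarrow> real ^ 'd)
     \<Rightarrow> (real ^ 'd \<Rightarrow> real) \<Rightarrow> real \<Rightarrow> real" where
  "pathwise_covariation m \<tau> \<omega> f t = lim (covariation_sum m \<tau> \<omega> f t)"

end

theory Submission
  imports Defs
begin

text \<open>For a \<open>C\<^sup>2\<close> function \<open>f\<close>, Taylor's formula along the stopped partition points turns the
  covariation sums into sums of the Hessian quadratic form evaluated at the increments of the path;
  these converge because the path has quadratic variation, and this gives the pathwise Ito formula.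
  The support of each segment density is contained in a ball that shrinks with the oscillation, and
  the mass of the density is at least a dimensional constant times the squared increment. Since the
  Hessian is uniformly continuous near the path, the limit of the quadratic sums is therefore
  bounded by a constant times the occupation seminorm of the Hessian. Applied to differences of
  Hessians, this makes the covariations of the approximating functions a Cauchy sequence whose limit
  does not depend on the approximation, and the integrals then converge by the Ito formula.\<close>

section \<open>Quadratic form of a matrix field along an increment\<close>

lemma norm_matrix_vector_le:
  fixes A :: "real ^ 'n ^ 'm"
  shows "norm (A *v v) \<le> norm A * norm v"
proof -
  have "norm (A *v v) = L2_set (\<lambda>i. \<bar>A $ i \<bullet> v\<bar>) UNIV"
    by (simp add: norm_vec_def matrix_vector_mul_component)
  also have "\<dots> \<le> L2_set (\<lambda>i. norm (A $ i) * norm v) UNIV"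
    by (intro L2_set_mono Cauchy_Schwarz_ineq2) auto
  also have "\<dots> = norm A * norm v"
    by (simp add: norm_vec_def[of A] L2_set_left_distrib)
  finally show ?thesis .
qed

text \<open>The matrix field is frozen at the starting point \<open>x\<close> of the increment, as
  in Taylor's formula at \<open>x\<close>.\<close>

definition quad :: "(real ^ 'd \<Rightarrow> real ^ 'd ^ 'd) \<Rightarrow> real ^ 'd \<Rightarrow> real ^ 'd \<Rightarrow> real" where
  "quad H x y = (y - x) \<bullet> (H x *v (y - x))"

lemma abs_inner_matrix_le:
  fixes A :: "real ^ 'd ^ 'd"
  shows "\<bar>v \<bullet> (A *v v)\<bar> \<le> norm A * (norm v)\<^sup>2"
proof -
  have "\<bar>v \<bullet> (A *v v)\<bar> \<le> norm v * norm (A *v v)" by (rule Cauchy_Schwarz_ineq2)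
  also have "\<dots> \<le> norm v * (norm A * norm v)"
    by (intro mult_left_mono norm_matrix_vector_le) auto
  finally show ?thesis by (simp add: power2_eq_square algebra_simps)
qed

lemma abs_quad_le: "\<bar>quad H x y\<bar> \<le> norm (H x) * (norm (y - x))\<^sup>2"
  unfolding quad_def by (rule abs_inner_matrix_le)

lemma quad_diff: "quad (\<lambda>x. H x - K x) x y = quad H x y - quad K x y"
  by (simp add: quad_def matrix_vector_mult_diff_rdistrib inner_diff_right)

lemma quad_eq_sum:
  "quad H x y = (\<Sum>a\<in>UNIV. \<Sum>b\<in>UNIV. H x $ a $ b * ((y $ a - x $ a) * (y $ b - x $ b)))"
  by (simp add: quad_def inner_vec_def matrix_vector_mult_def sum_distrib_left algebra_simps)

section \<open>Second-order Taylor estimates\<close>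

lemma has_derivative_grad:
  assumes "f differentiable (at x)"
  shows "(f has_derivative (\<lambda>v. grad f x \<bullet> v)) (at x)"
proof -
  let ?D = "frechet_derivative f (at x)"
  have D: "(f has_derivative ?D) (at x)" using assms frechet_derivative_works by blast
  then interpret bounded_linear ?D by (rule has_derivative_bounded_linear)
  have "?D v = grad f x \<bullet> v" for v
  proof -
    have "?D v = ?D (\<Sum>i\<in>UNIV. v $ i *\<^sub>R axis i 1)"
      by (simp add: basis_expansion flip: scalar_mult_eq_scaleR)
    also have "\<dots> = grad f x \<bullet> v"
      by (simp add: sum scale grad_def inner_vec_def mult.commute)
    finally show ?thesis .
  qed
  with D show ?thesis by (metis (no_types, lifting) ext)
qed

lemma C_2D:
  assumes "C_k 2 f"
  shows C_2_grad: "(f has_derivative (\<lambda>v. grad f x \<bullet> v)) (at x)"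
    and C_2_hess: "((\<lambda>y. grad f y $ i) has_derivative (\<lambda>v. hess f x $ i \<bullet> v)) (at x)"
    and C_2_continuous_hess: "continuous_on UNIV (hess f)"
proof -
  have 1: "\<And>x. f differentiable (at x)" "\<And>x i. (\<lambda>y. grad f y $ i) differentiable (at x)"
    "\<And>i j. continuous_on UNIV (\<lambda>x. grad (\<lambda>y. grad f y $ i) x $ j)"
    using assms by (auto simp: numeral_2_eq_2)
  show "(f has_derivative (\<lambda>v. grad f x \<bullet> v)) (at x)"
    using 1 by (intro has_derivative_grad)
  show "((\<lambda>y. grad f y $ i) has_derivative (\<lambda>v. hess f x $ i \<bullet> v)) (at x)"
    using has_derivative_grad[OF 1(2)] by (simp add: hess_def)
  have "hess f = (\<lambda>x. \<chi> i j. grad (\<lambda>y. grad f y $ i) x $ j)"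
    by (auto simp: hess_def vec_eq_iff)
  then show "continuous_on UNIV (hess f)"
    using 1(3) by (simp only:) (intro continuous_on_vec_lambda)
qed

text \<open>On the segment from \<open>x\<close> to \<open>y\<close> everything reduces to one
  variable, and each remainder is, up to a factor, the second derivative at an intermediate point
  minus its value at \<open>x\<close>. The first estimate serves the integral sums, the second the
  covariation sums.\<close>

lemma C_2_Taylor:
  assumes f: "C_k 2 f" and e: "\<And>z. z \<in> closed_segment x y \<Longrightarrow> norm (hess f z - hess f x) \<le> e"
  shows "\<bar>f y - f x - grad f x \<bullet> (y - x) - quad (hess f) x y / 2\<bar> \<le> e * (norm (y - x))\<^sup>2"
    and "\<bar>(grad f y - grad f x) \<bullet> (y - x) - quad (hess f) x y\<bar> \<le> e * (norm (y - x))\<^sup>2"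
proof -
  define v where "v = y - x"
  \<comment> \<open>For \<open>k \<le> 2\<close> this is the derivative of order \<open>k\<close> of
    \<open>f\<close> along the line, in the indexed form that \<open>Maclaurin\<close>
    expects.\<close>
  define h where "h k s = (if k = 0 then f (x + s *\<^sub>R v) else if k = 1 then grad f (x + s *\<^sub>R v) \<bullet> v
     else v \<bullet> (hess f (x + s *\<^sub>R v) *v v))" for k :: nat and s :: real
  have h_fun: "h 0 = (\<lambda>s. f (x + s *\<^sub>R v))" "h 1 = (\<lambda>s. grad f (x + s *\<^sub>R v) \<bullet> v)"
    "h 2 = (\<lambda>s. v \<bullet> (hess f (x + s *\<^sub>R v) *v v))"
    by (auto simp: h_def)
  have line: "((\<lambda>s. x + s *\<^sub>R v) has_derivative (\<lambda>t. t *\<^sub>R v)) (at s)" for s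
    by (auto intro!: derivative_eq_intros)
  have d0: "DERIV (h 0) s :> h 1 s" for s
    using has_derivative_compose[OF line C_2_grad[OF f], of s]
    by (simp add: h_fun h_fun(2)[unfolded One_nat_def] has_field_derivative_def mult.commute[of _ "_ \<bullet> _"])
  \<comment> \<open>The rows of \<open>hess f\<close> are the gradients of the components of
    \<open>grad f\<close>, so the derivative is taken coordinate by coordinate and reassembled into
    the quadratic form.\<close>
  have "((\<lambda>s. \<Sum>i\<in>UNIV. grad f (x + s *\<^sub>R v) $ i * v $ i) has_derivative
      (\<lambda>t. \<Sum>i\<in>UNIV. (hess f (x + s *\<^sub>R v) $ i \<bullet> (t *\<^sub>R v)) * v $ i)) (at s)" for s
    by (intro has_derivative_sum has_derivative_mult_left
        has_derivative_compose[OF line C_2_hess[OF f]])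
  then have "((\<lambda>s. grad f (x + s *\<^sub>R v) \<bullet> v) has_derivative
      (\<lambda>t. v \<bullet> (hess f (x + s *\<^sub>R v) *v v) * t)) (at s)" for s
    by (simp add: inner_vec_def[of v] inner_vec_def[of _ v] matrix_vector_mul_component
        sum_distrib_left sum_distrib_right algebra_simps)
  then have d1: "DERIV (h 1) s :> h 2 s" for s
    by (simp add: h_fun h_fun(2)[unfolded One_nat_def] has_field_derivative_def)
  have h2: "\<bar>h 2 s - h 2 0\<bar> \<le> e * (norm v)\<^sup>2" if "0 \<le> s" "s \<le> 1" for s
  proof -
    have "x + s *\<^sub>R v \<in> closed_segment x y"
      using that by (auto simp: closed_segment_def v_def algebra_simps intro!: exI[of _ s])
    then have "norm (hess f (x + s *\<^sub>R v) - hess f x) * (norm v)\<^sup>2 \<le> e * (norm v)\<^sup>2"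
      by (intro mult_right_mono e) auto
    moreover have "h 2 s - h 2 0 = v \<bullet> ((hess f (x + s *\<^sub>R v) - hess f x) *v v)"
      by (simp add: h_def matrix_vector_mult_diff_rdistrib inner_diff_right)
    ultimately show ?thesis using abs_inner_matrix_le order_trans by metis
  qed
  have q: "quad (hess f) x y = h 2 0" by (simp add: h_def quad_def v_def)
  have "\<exists>t::real. 0 < t \<and> t < 1 \<and>
      h 0 1 = (\<Sum>m<2. (h m 0 / fact m) * 1 ^ m) + (h 2 t / fact 2) * 1 ^ 2"
    using d0 d1 by (intro Maclaurin) (auto simp: less_2_cases_iff simp flip: numeral_2_eq_2)
  then obtain t where t: "0 < t" "t < 1" "h 0 1 = h 0 0 + h 1 0 + h 2 t / 2"
    by (auto simp: numeral_2_eq_2)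
  have "f y - f x - grad f x \<bullet> (y - x) - quad (hess f) x y / 2 = (h 2 t - h 2 0) / 2"
    using t(3) unfolding q by (simp add: h_def v_def field_simps)
  then show "\<bar>f y - f x - grad f x \<bullet> (y - x) - quad (hess f) x y / 2\<bar> \<le> e * (norm (y - x))\<^sup>2"
    using h2[of t] t by (simp add: v_def)
  obtain u where u: "0 < u" "u < 1" "h 1 1 - h 1 0 = (1 - 0) * h 2 u"
    using MVT2[of 0 1 "h 1" "h 2"] d1 by auto
  have "(grad f y - grad f x) \<bullet> (y - x) - quad (hess f) x y = h 2 u - h 2 0"
    using u(3) unfolding q by (simp add: h_def v_def inner_diff_left)
  then show "\<bar>(grad f y - grad f x) \<bullet> (y - x) - quad (hess f) x y\<bar> \<le> e * (norm (y - x))\<^sup>2"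
    using h2[of u] u by (simp add: v_def)
qed

section \<open>Lower bounds for the segment densities\<close>

lemma segment_density_nonneg: "0 \<le> segment_density a b x"
  by (auto simp: segment_density_def intro!: mult_nonneg_nonneg add_nonneg_nonneg)

lemma segment_density_measurable: "segment_density a b \<in> borel_measurable lebesgue"
proof -
  have "segment_density a b \<in> borel_measurable lborel"
    unfolding segment_density_def power_int_def
    by (intro measurable_If borel_measurable_times borel_measurable_indicator) measurable
  then show ?thesis by (rule measurable_completion)
qed

text \<open>The centre of the ball is one radius away from \<open>a\<close>. The bound is used
  twice: for the size of the density, and to keep its support close to the path when the increment
  is short.\<close>

lemma norm_le_if_in_diameter_cball:
  fixes a b x :: "'a :: real_normed_vector"
  assumes "x \<in> cball ((1/2) *\<^sub>R (a + b)) ((1/2) * norm (b - a))"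
  shows "norm (x - a) \<le> norm (b - a)"
proof -
  have half: "(1/2) *\<^sub>R (a + b) - a = (1/2) *\<^sub>R (b - a)"
    using scaleR_add_left[of "1/2" "1/2" a] by (simp add: algebra_simps)
  have "norm (x - a) \<le> norm ((1/2) *\<^sub>R (a + b) - a) + norm ((1/2) *\<^sub>R (a + b) - x)"
    using norm_triangle_ineq4[of "(1/2) *\<^sub>R (a + b) - a" "(1/2) *\<^sub>R (a + b) - x"] by simp
  then show ?thesis using assms unfolding half by (simp add: dist_norm)
qed

text \<open>In dimension at least two the term at \<open>a\<close> suffices, because
  \<open>x\<close> is no farther from \<open>a\<close> than \<open>b\<close> is and the exponent is
  nonnegative. In dimension one the exponent is \<open>-1\<close>, both terms are plain distances to
  the endpoints, and the triangle inequality bounds their sum from below.\<close>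

lemma segment_density_ge:
  fixes a b x :: "real ^ 'd"
  assumes x: "x \<in> cball ((1/2) *\<^sub>R (a + b)) ((1/2) * norm (b - a))" and "x \<noteq> a" "x \<noteq> b" "a \<noteq> b"
  shows "2 / measure lebesgue (ball (0 :: real ^ 'd) 1) * norm (b - a) powi (2 - int CARD('d))
    \<le> segment_density a b x"
proof -
  define R where "R = norm (b - a)"
  have R: "R > 0" using assms by (simp add: R_def)
  have xa: "norm (x - a) \<le> R"
    using norm_le_if_in_diameter_cball[OF x] by (simp add: R_def)
  have pos: "norm (x - a) > 0" "norm (x - b) > 0" using assms by auto
  have "R powi (2 - int CARD('d)) \<le>
     1 / norm (x - a) powi (int CARD('d) - 2) + 1 / norm (x - b) powi (int CARD('d) - 2)"
  proof (cases "CARD('d) \<ge> 2")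
    case True
    have "R powi (2 - int CARD('d)) = 1 / R powi (int CARD('d) - 2)"
      using power_int_minus_divide[of R "int CARD('d) - 2"] by simp
    also have "\<dots> \<le> 1 / norm (x - a) powi (int CARD('d) - 2)"
      using True xa pos R
      by (intro divide_left_mono power_int_mono mult_pos_pos zero_less_power_int) auto
    also have "\<dots> \<le> \<dots> + 1 / norm (x - b) powi (int CARD('d) - 2)" using pos by simp
    finally show ?thesis by linarith
  next
    case False
    moreover have "CARD('d) > 0" by simp
    ultimately have 1: "CARD('d) = 1" by linarith
    have "R \<le> norm (x - a) + norm (x - b)"
      unfolding R_def using norm_triangle_ineq4[of "x - a" "x - b"] by simp
    then show ?thesis by (simp add: 1 power_int_minus divide_inverse)
  qed
  then have "2 / measure lebesgue (ball (0 :: real ^ 'd) 1) * R powi (2 - int CARD('d)) \<le>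
     2 / measure lebesgue (ball (0 :: real ^ 'd) 1) *
     (1 / norm (x - a) powi (int CARD('d) - 2) + 1 / norm (x - b) powi (int CARD('d) - 2))"
    by (intro mult_left_mono) auto
  then show ?thesis using assms by (simp add: segment_density_def R_def)
qed

text \<open>The exact mass is \<open>(norm (b - a))\<^sup>2\<close>. The weaker constant \<open>2 / 2 ^ CARD('d)\<close> follows from
  the pointwise bound above without polar coordinates and is enough for a Cauchy argument.\<close>

lemma segment_density_mass:
  fixes a b :: "real ^ 'd"
  assumes c: "c \<ge> 0" and g: "\<And>x. x \<in> cball ((1/2) *\<^sub>R (a + b)) ((1/2) * norm (b - a)) \<Longrightarrow> c \<le> g x"
  shows "ennreal (c * (2 / 2 ^ CARD('d) * (norm (b - a))\<^sup>2))
    \<le> (\<integral>\<^sup>+ x. ennreal (g x * segment_density a b x) \<partial>lebesgue)"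
proof (cases "a = b")
  case False
  define R where "R = norm (b - a)"
  define w where "w = measure lebesgue (ball (0 :: real ^ 'd) 1)"
  define B where "B = cball ((1/2) *\<^sub>R (a + b)) ((1/2) * R)"
  define p where "p = R powi (2 - int CARD('d))"
  have R: "R > 0" using False by (simp add: R_def)
  have w: "w > 0" using content_ball_pos[of 1 "0 :: real ^ 'd"] by (simp add: w_def)
  have p: "p > 0" using R by (simp add: p_def)
  have B: "measure lebesgue B = (R / 2) ^ CARD('d) * w"
    using content_ball_conv_unit_ball[of "R / 2" "(1/2) *\<^sub>R (a + b)"] R
    by (simp add: B_def w_def content_cball_conv_ball)
  have emB: "emeasure lebesgue B = ennreal (measure lebesgue B)"
    unfolding B_def by (intro emeasure_eq_ennreal_measure) (use emeasure_lborel_cball_finite[of "(1/2) *\<^sub>R (a + b)" "R / 2"] in simp)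
  \<comment> \<open>The powers of \<open>R\<close> combine to a square, the volume of the unit ball
    cancels against the normalising constant, and the radius \<open>R / 2\<close> leaves the factor
    \<open>2 ^ CARD('d)\<close> in the denominator.\<close>
  have pR: "p * R ^ CARD('d) = R\<^sup>2"
    using R by (simp add: p_def power_int_diff)
  have "c * (2 / 2 ^ CARD('d) * R\<^sup>2) = (c * (2 / w * p)) * measure lebesgue B"
    unfolding B pR[symmetric] using w by (simp add: field_simps)
  then have "ennreal (c * (2 / 2 ^ CARD('d) * R\<^sup>2)) = ennreal (c * (2 / w * p)) * emeasure lebesgue B"
    using c w p by (simp only: emB) (simp add: ennreal_mult'[symmetric])
  also have "\<dots> = (\<integral>\<^sup>+ x. ennreal (c * (2 / w * p)) * indicator B x \<partial>lebesgue)"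
    by (simp add: nn_integral_cmult_indicator B_def)
  also have "\<dots> \<le> (\<integral>\<^sup>+ x. ennreal (g x * segment_density a b x) \<partial>lebesgue)"
  proof (intro nn_integral_mono_AE)
    \<comment> \<open>The pointwise bound leaves out the two endpoints, which form a null
      set.\<close>
    have "AE x in lborel. x \<noteq> a \<and> x \<noteq> b"
      using AE_lborel_singleton[of a] AE_lborel_singleton[of b] by eventually_elim auto
    then have "AE x in lebesgue. x \<noteq> a \<and> x \<noteq> b" by (rule AE_completion)
    then show "AE x in lebesgue. ennreal (c * (2 / w * p)) * indicator B x
        \<le> ennreal (g x * segment_density a b x)"
    proof eventually_elim
      case (elim x)
      show ?case
      proof (cases "x \<in> B")
        case True
        have "2 / w * p \<le> segment_density a b x"
          using True elim False unfolding w_def p_def R_def B_def by (intro segment_density_ge) auto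
        moreover have "c \<le> g x" using True g unfolding B_def R_def by auto
        ultimately have "c * (2 / w * p) \<le> g x * segment_density a b x"
          using c w p by (intro mult_mono) auto
        then show ?thesis using True by (simp add: ennreal_leI)
      qed auto
    qed
  qed
  finally show ?thesis by (simp add: R_def)
qed simp

section \<open>Convergence of weighted quadratic variation sums\<close>

text \<open>Completeness supplies the limit, so the comparison sequence may change with the
  tolerance and no candidate for the limit has to be named.\<close>

lemma convergent_uniform_approx:
  fixes X :: "nat \<Rightarrow> real"
  assumes "\<And>e. e > 0 \<Longrightarrow> \<exists>R. convergent R \<and> (\<forall>\<^sub>F n in sequentially. \<bar>X n - R n\<bar> \<le> e)"
  shows "convergent X"
proof -
  have "Cauchy X"
  proof (rule metric_CauchyI)
    fix e :: real assume e: "e > 0"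
    obtain R where R: "convergent R" "\<forall>\<^sub>F n in sequentially. \<bar>X n - R n\<bar> \<le> e / 4"
      using assms[of "e / 4"] e by auto
    from R(1) have "Cauchy R" by (simp add: Cauchy_convergent_iff)
    then obtain M where M: "\<And>i j. i \<ge> M \<Longrightarrow> j \<ge> M \<Longrightarrow> dist (R i) (R j) < e / 4"
      using e unfolding Cauchy_def by (metis zero_less_divide_iff zero_less_numeral)
    from R(2) obtain N where N: "\<And>n. n \<ge> N \<Longrightarrow> \<bar>X n - R n\<bar> \<le> e / 4"
      by (auto simp: eventually_sequentially)
    have "dist (X i) (X j) < e" if "i \<ge> max M N" "j \<ge> max M N" for i j
      using M[of i j] N[of i] N[of j] that e unfolding dist_real_def by linarith
    then show "\<exists>M. \<forall>i\<ge>M. \<forall>j\<ge>M. dist (X i) (X j) < e" by blast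
  qed
  then show ?thesis by (simp add: Cauchy_convergent_iff)
qed

locale qv_path =
  fixes T :: real and m :: "nat \<Rightarrow> nat" and \<tau> :: "nat \<Rightarrow> nat \<Rightarrow> real" and \<omega> :: "real \<Rightarrow> real ^ 'd"
  assumes T: "T > 0" and part: "is_partition_seq T m \<tau>" and vQ: "vector_Q T m \<tau> \<omega>"
    and osc0: "osc m \<tau> \<omega> \<longlonglongrightarrow> 0"
begin

text \<open>Two truncations at time \<open>t\<close> occur: quadratic variation counts the intervals
  completed by \<open>t\<close>, while integrals and covariations use the stopped path
  \<open>stop\<close>. They are reconciled in \<open>stopped_sum_tendsto\<close>.\<close>

definition idx :: "nat \<Rightarrow> real \<Rightarrow> nat set" where
  "idx n t = {i. i < m n \<and> \<tau> n (Suc i) \<le> t}"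

definition stop :: "real \<Rightarrow> nat \<Rightarrow> nat \<Rightarrow> real ^ 'd" where
  "stop t n k = \<omega> (min (\<tau> n k) t)"

lemma finite_idx [simp]: "finite (idx n t)"
  by (simp add: idx_def)

lemma tau_mono: "i \<le> j \<Longrightarrow> j \<le> m n \<Longrightarrow> \<tau> n i \<le> \<tau> n j"
proof (induction j rule: dec_induct)
  case (step j)
  then have "\<tau> n j < \<tau> n (Suc j)" using part by (simp add: is_partition_seq_def)
  with step show ?case by simp
qed simp

lemma tau_0 [simp]: "\<tau> n 0 = 0" and tau_m [simp]: "\<tau> n (m n) = T"
  using part by (auto simp: is_partition_seq_def)

lemma tau_in: "i \<le> m n \<Longrightarrow> \<tau> n i \<in> {0..T}"
  using tau_mono[of 0 i n] tau_mono[of i "m n" n] by auto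

lemma continuous_path: "continuous_on {0..T} \<omega>"
  using vQ by (simp add: vector_Q_def)

text \<open>Continuity on the compact partition interval bounds the set under the supremum, so the
  supremum in \<open>osc\<close> really dominates each single time, including times strictly inside
  the interval.\<close>

lemma osc_small:
  assumes "e > 0"
  shows "\<forall>\<^sub>F n in sequentially. \<forall>i<m n. \<forall>u\<in>{\<tau> n i..\<tau> n (Suc i)}. norm (\<omega> u - \<omega> (\<tau> n i)) < e"
proof -
  have "\<forall>\<^sub>F n in sequentially. osc m \<tau> \<omega> n < e"
    using osc0 assms by (rule order_tendstoD)
  then show ?thesis
  proof eventually_elim
    case (elim n)
    show ?case
    proof (intro allI impI ballI)
      fix i u assume i: "i < m n" and u: "u \<in> {\<tau> n i..\<tau> n (Suc i)}"
      let ?g = "\<lambda>t. norm (\<omega> t - \<omega> (\<tau> n i))"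
      have "{\<tau> n i..\<tau> n (Suc i)} \<subseteq> {0..T}" using tau_in[of i n] tau_in[of "Suc i" n] i by auto
      then have "continuous_on {\<tau> n i..\<tau> n (Suc i)} ?g"
        by (intro continuous_intros continuous_on_subset[OF continuous_path])
      then have "compact (?g ` {\<tau> n i..\<tau> n (Suc i)})"
        by (rule compact_continuous_image) simp
      then have "bdd_above (?g ` {\<tau> n i..\<tau> n (Suc i)})"
        by (intro bounded_imp_bdd_above compact_imp_bounded)
      then have "?g u \<le> (SUP t\<in>{\<tau> n i..\<tau> n (Suc i)}. ?g t)" using u by (rule cSUP_upper2) auto
      also have "\<dots> \<le> osc m \<tau> \<omega> n" unfolding osc_def using i by (intro Max_ge) auto
      finally show "?g u < e" using elim by simp
    qed
  qed
qed

text \<open>The mesh of the partitions need not tend to zero, only the oscillation of the path does. The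
  weight is therefore compared with a step function on a fixed grid, which is independent of the
  partitions and turns the sum into a finite combination of quadratic variation sums.\<close>

lemma weighted_square_sum_convergent:
  assumes x: "scalar_Q T m \<tau> x" and g: "continuous_on {0..T} g"
    and g_osc: "\<And>e. e > 0 \<Longrightarrow> \<forall>\<^sub>F n in sequentially. \<forall>i<m n. \<bar>g (\<tau> n (Suc i)) - g (\<tau> n i)\<bar> \<le> e"
    and t: "t \<in> {0..T}"
  shows "convergent (\<lambda>n. \<Sum>i\<in>idx n t. g (\<tau> n i) * (x (\<tau> n (Suc i)) - x (\<tau> n i))\<^sup>2)"
proof -
  define D where "D n i = (x (\<tau> n (Suc i)) - x (\<tau> n i))\<^sup>2" for n i
  define A where "A s n = (\<Sum>i\<in>idx n s. D n i)" for s n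
  \<comment> \<open>The weight sits at the right endpoint: an interval that ends in
    \<open>(r, s]\<close> has its right endpoint near \<open>s\<close>, whereas its left endpoint
    can be far away. At the end \<open>g_osc\<close> moves the weight back to the left
    endpoint.\<close>
  define S where "S s n = (\<Sum>i\<in>idx n s. g (\<tau> n (Suc i)) * D n i)" for s n
  have D: "D n i \<ge> 0" for n i by (simp add: D_def)
  have A: "convergent (A s)" if "s \<in> {0..T}" for s
    using x that unfolding scalar_Q_def A_def idx_def D_def convergent_def by blast
  \<comment> \<open>induction over the grid points \<open>s - d, s - 2 * d, \<dots>\<close>\<close>
  have step: "\<exists>R. convergent R \<and> (\<forall>n. \<bar>S s n - R n\<bar> \<le> e * A s n)"
    if "d > 0" and g_unif: "\<And>u v. u \<in> {0..T} \<Longrightarrow> v \<in> {0..T} \<Longrightarrow> \<bar>u - v\<bar> \<le> d \<Longrightarrow> \<bar>g u - g v\<bar> \<le> e"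
      and s: "s \<in> {0..T}" "s \<le> real j * d" for d e s j
    using s
  proof (induction j arbitrary: s)
    case 0
    then have "s = 0" by simp
    have "\<not> \<tau> n (Suc i) \<le> 0" if "i < m n" for i n
    proof -
      have "\<tau> n i < \<tau> n (Suc i)" using part that by (simp add: is_partition_seq_def)
      then show ?thesis using tau_in[of i n] that by auto
    qed
    then have "idx n s = {}" for n using \<open>s = 0\<close> by (auto simp: idx_def)
    then show ?case by (intro exI[of _ "\<lambda>_. 0"]) (auto simp: S_def A_def convergent_const)
  next
    case (Suc j)
    \<comment> \<open>Truncation at \<open>0\<close> keeps the previous grid point in
      \<open>{0..T}\<close>, where the induction hypothesis applies.\<close>
    define r where "r = max 0 (s - d)"
    have r: "r \<in> {0..T}" "r \<le> real j * d" "r \<le> s" "s - d \<le> r"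
      using Suc.prems \<open>d > 0\<close> by (auto simp: r_def algebra_simps)
    obtain R where R: "convergent R" "\<And>n. \<bar>S r n - R n\<bar> \<le> e * A r n"
      using Suc.IH r by blast
    have split: "(\<Sum>i\<in>idx n s. f i) = (\<Sum>i\<in>idx n r. f i) + (\<Sum>i\<in>idx n s - idx n r. f i)"
      for f :: "nat \<Rightarrow> real" and n
      using sum.subset_diff[of "idx n r" "idx n s" f] r(3) by (fastforce simp: idx_def)
    \<comment> \<open>On the intervals ending in \<open>(r, s]\<close> the weight is replaced by the
      constant \<open>g s\<close>, which leaves a difference of two unweighted sums, both
      convergent.\<close>
    have "\<bar>S s n - (R n + g s * (A s n - A r n))\<bar> \<le> e * A s n" for n
    proof -
      have "S s n - (R n + g s * (A s n - A r n)) =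
          (S r n - R n) + (\<Sum>i\<in>idx n s - idx n r. (g (\<tau> n (Suc i)) - g s) * D n i)"
        unfolding S_def A_def split
        by (simp add: left_diff_distrib sum_subtractf sum_distrib_left)
      also have "\<bar>\<dots>\<bar> \<le> e * A r n + (\<Sum>i\<in>idx n s - idx n r. e * D n i)"
      proof (intro order_trans[OF abs_triangle_ineq] add_mono R order_trans[OF sum_abs] sum_mono)
        fix i assume i: "i \<in> idx n s - idx n r"
        then have "\<bar>g (\<tau> n (Suc i)) - g s\<bar> \<le> e"
          using r Suc.prems tau_in[of "Suc i" n] by (intro g_unif) (auto simp: idx_def)
        then show "\<bar>(g (\<tau> n (Suc i)) - g s) * D n i\<bar> \<le> e * D n i"
          using D by (auto simp: abs_mult intro!: mult_right_mono)
      qed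
      also have "\<dots> = e * A s n"
        unfolding A_def split by (simp add: algebra_simps sum_distrib_left)
      finally show ?thesis .
    qed
    moreover have "convergent (\<lambda>n. R n + g s * (A s n - A r n))"
      by (intro convergent_add convergent_diff convergent_mult convergent_const R A r Suc.prems)
    ultimately show ?case by (intro exI[of _ "\<lambda>n. R n + g s * (A s n - A r n)"]) simp
  qed
  obtain M where M: "M > 0" "\<And>n. \<bar>A t n\<bar> \<le> M"
    using convergent_imp_Bseq[OF A[OF t]] by (auto elim!: BseqE)
  show ?thesis
  proof (rule convergent_uniform_approx)
    fix e :: real assume e: "e > 0"
    \<comment> \<open>Two errors of at most \<open>e' * M\<close> each add up to \<open>e\<close>:
      one from the step function, one from moving the weight between endpoints.\<close>
    define e' where "e' = e / (2 * M)"
    have e': "e' > 0" using e M by (simp add: e'_def)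
    have "uniformly_continuous_on {0..T} g"
      using g by (rule compact_uniformly_continuous) simp
    then obtain d where d: "d > 0"
      "\<And>u v. u \<in> {0..T} \<Longrightarrow> v \<in> {0..T} \<Longrightarrow> dist u v < d \<Longrightarrow> dist (g u) (g v) < e'"
      using e' unfolding uniformly_continuous_on_def by metis
    \<comment> \<open>The grid has width \<open>d / 2\<close> because uniform continuity gives a
      strict inequality while \<open>step\<close> asks for a weak one.\<close>
    obtain j where j: "t \<le> real j * (d / 2)"
      using reals_Archimedean3[of "d / 2"] d(1) by (metis half_gt_zero less_imp_le)
    have "\<exists>R. convergent R \<and> (\<forall>n. \<bar>S t n - R n\<bar> \<le> e' * A t n)"
    proof (rule step[OF _ _ t j])
      fix u v assume "u \<in> {0..T}" "v \<in> {0..T}" "\<bar>u - v\<bar> \<le> d / 2"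
      then show "\<bar>g u - g v\<bar> \<le> e'"
        using d(1) d(2)[of u v] by (simp add: dist_real_def)
    qed (use d in simp)
    then obtain R where R: "convergent R" "\<And>n. \<bar>S t n - R n\<bar> \<le> e' * A t n" by blast
    have "\<forall>\<^sub>F n in sequentially. \<bar>(\<Sum>i\<in>idx n t. g (\<tau> n i) * D n i) - R n\<bar> \<le> e"
      using g_osc[OF e']
    proof eventually_elim
      case (elim n)
      have "\<bar>(\<Sum>i\<in>idx n t. g (\<tau> n i) * D n i) - S t n\<bar> \<le> (\<Sum>i\<in>idx n t. e' * D n i)"
        unfolding S_def sum_subtractf[symmetric]
      proof (intro order_trans[OF sum_abs] sum_mono)
        fix i assume "i \<in> idx n t"
        then have "\<bar>g (\<tau> n i) - g (\<tau> n (Suc i))\<bar> \<le> e'"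
          using elim by (auto simp: idx_def abs_minus_commute)
        then show "\<bar>g (\<tau> n i) * D n i - g (\<tau> n (Suc i)) * D n i\<bar> \<le> e' * D n i"
          using D by (auto simp: abs_mult simp flip: left_diff_distrib intro!: mult_right_mono)
      qed
      also have "\<dots> = e' * A t n" by (simp add: A_def sum_distrib_left)
      finally have "\<bar>(\<Sum>i\<in>idx n t. g (\<tau> n i) * D n i) - R n\<bar> \<le> 2 * (e' * A t n)"
        using R(2)[of n] by linarith
      also have "\<dots> \<le> 2 * (e' * M)" using M(2)[of n] e' by (auto intro!: mult_left_mono)
      also have "\<dots> = e" using M by (simp add: e'_def)
      finally show ?case .
    qed
    with R(1) show "\<exists>R. convergent R \<and> (\<forall>\<^sub>F n in sequentially.
        \<bar>(\<Sum>i\<in>idx n t. g (\<tau> n i) * (x (\<tau> n (Suc i)) - x (\<tau> n i))\<^sup>2) - R n\<bar> \<le> e)"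
      unfolding D_def by blast
  qed
qed

text \<open>In coordinates each entry of \<open>H\<close> along the path is a continuous weight, and
  each product of two coordinate increments is a combination of squared increments of coordinates
  and of sums of two coordinates. All of these have quadratic variation by
  \<open>vector_Q\<close>.\<close>

lemma quad_sum_convergent:
  assumes H: "continuous_on UNIV H" and t: "t \<in> {0..T}"
  shows "convergent (\<lambda>n. \<Sum>i\<in>idx n t. quad H (\<omega> (\<tau> n i)) (\<omega> (\<tau> n (Suc i))))"
proof -
  define g where "g a b u = H (\<omega> u) $ a $ b" for a b u
  define sq where "sq n i x = (x (\<tau> n (Suc i)) - x (\<tau> n i))\<^sup>2" for n i and x :: "real \<Rightarrow> real"
  have Hab: "continuous_on S (\<lambda>x. H x $ a $ b)" for a b S
    by (intro continuous_intros continuous_on_subset[OF H]) auto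
  have g: "continuous_on {0..T} (g a b)" for a b
    unfolding g_def using Hab by (rule continuous_on_compose2[OF _ continuous_path]) auto
  \<comment> \<open>Since the mesh may stay large, small weight increments come from small path
    increments, through uniform continuity of \<open>H\<close> on the compact range of the
    path.\<close>
  have g_osc: "\<forall>\<^sub>F n in sequentially. \<forall>i<m n. \<bar>g a b (\<tau> n (Suc i)) - g a b (\<tau> n i)\<bar> \<le> e"
    if e: "e > 0" for a b and e :: real
  proof -
    have "uniformly_continuous_on (\<omega> ` {0..T}) (\<lambda>x. H x $ a $ b)"
      by (intro compact_uniformly_continuous Hab compact_continuous_image continuous_path) simp
    then obtain d where d: "d > 0" "\<And>u v. u \<in> {0..T} \<Longrightarrow> v \<in> {0..T} \<Longrightarrow>
        dist (\<omega> u) (\<omega> v) < d \<Longrightarrow> dist (g a b u) (g a b v) < e"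
      using e unfolding uniformly_continuous_on_def g_def by (metis imageI)
    show ?thesis using osc_small[OF d(1)]
    proof eventually_elim
      case (elim n)
      show ?case
      proof (intro allI impI)
        fix i assume i: "i < m n"
        then have "norm (\<omega> (\<tau> n (Suc i)) - \<omega> (\<tau> n i)) < d"
          using elim tau_mono[of i "Suc i" n] by auto
        then show "\<bar>g a b (\<tau> n (Suc i)) - g a b (\<tau> n i)\<bar> \<le> e"
          using d(2)[of "\<tau> n (Suc i)" "\<tau> n i"] tau_in[of i n] tau_in[of "Suc i" n] i
          by (simp add: dist_norm)
      qed
    qed
  qed
  have conv: "convergent (\<lambda>n. \<Sum>i\<in>idx n t. g a b (\<tau> n i) * sq n i x)" if "scalar_Q T m \<tau> x" for a b x
    unfolding sq_def using that g g_osc t by (rule weighted_square_sum_convergent)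
  have swap: "(\<Sum>i\<in>I. \<Sum>a\<in>UNIV. \<Sum>b\<in>UNIV. f i a b) = (\<Sum>a\<in>UNIV. \<Sum>b\<in>UNIV. \<Sum>i\<in>I. f i a b)"
    for I and f :: "nat \<Rightarrow> 'd \<Rightarrow> 'd \<Rightarrow> real"
    by (subst sum.swap) (intro sum.cong refl sum.swap)
  \<comment> \<open>polarization of the mixed products\<close>
  have "quad H (\<omega> (\<tau> n i)) (\<omega> (\<tau> n (Suc i))) = (\<Sum>a\<in>UNIV. \<Sum>b\<in>UNIV.
      1/2 * (g a b (\<tau> n i) * sq n i (\<lambda>u. \<omega> u $ a + \<omega> u $ b)
        - g a b (\<tau> n i) * sq n i (\<lambda>u. \<omega> u $ a) - g a b (\<tau> n i) * sq n i (\<lambda>u. \<omega> u $ b)))" for n i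
    unfolding quad_eq_sum g_def sq_def
    by (intro sum.cong refl) (simp add: power2_eq_square field_simps)
  then have "(\<Sum>i\<in>idx n t. quad H (\<omega> (\<tau> n i)) (\<omega> (\<tau> n (Suc i)))) = (\<Sum>a\<in>UNIV. \<Sum>b\<in>UNIV.
      1/2 * ((\<Sum>i\<in>idx n t. g a b (\<tau> n i) * sq n i (\<lambda>u. \<omega> u $ a + \<omega> u $ b))
        - (\<Sum>i\<in>idx n t. g a b (\<tau> n i) * sq n i (\<lambda>u. \<omega> u $ a))
        - (\<Sum>i\<in>idx n t. g a b (\<tau> n i) * sq n i (\<lambda>u. \<omega> u $ b))))" for n
    by (simp only: swap sum_subtractf right_diff_distrib sum_distrib_left)
  moreover have "convergent (\<lambda>n. \<Sum>a\<in>UNIV. \<Sum>b\<in>UNIV.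
      1/2 * ((\<Sum>i\<in>idx n t. g a b (\<tau> n i) * sq n i (\<lambda>u. \<omega> u $ a + \<omega> u $ b))
        - (\<Sum>i\<in>idx n t. g a b (\<tau> n i) * sq n i (\<lambda>u. \<omega> u $ a))
        - (\<Sum>i\<in>idx n t. g a b (\<tau> n i) * sq n i (\<lambda>u. \<omega> u $ b))))"
    using vQ unfolding vector_Q_def
    by (intro convergent_sum convergent_mult convergent_const convergent_diff conv) auto
  ultimately show ?thesis by simp
qed

end

section \<open>Stopped sums and the pathwise Ito formula for smooth functions\<close>

lemma tendsto_zero_if_eventually_le:
  fixes X :: "nat \<Rightarrow> real"
  assumes "\<And>e. e > 0 \<Longrightarrow> \<forall>\<^sub>F n in sequentially. \<bar>X n\<bar> \<le> e"
  shows "X \<longlonglongrightarrow> 0"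
proof (rule tendstoI)
  fix e :: real assume "e > 0"
  then have "\<forall>\<^sub>F n in sequentially. \<bar>X n\<bar> \<le> e / 2" by (intro assms) simp
  then show "\<forall>\<^sub>F n in sequentially. dist (X n) 0 < e"
    by eventually_elim (use \<open>e > 0\<close> in simp)
qed

context qv_path begin

text \<open>The point \<open>z\<close> may leave the range of the path, as Taylor segments and
  supports of densities do. Uniform continuity is therefore taken on a ball whose radius exceeds a
  bound of the path by one.\<close>

lemma path_locally_uniform:
  fixes H :: "real ^ 'd \<Rightarrow> 'b :: real_normed_vector"
  assumes H: "continuous_on UNIV H" and e: "e > 0"
  shows "\<exists>d>0. \<forall>u\<in>{0..T}. \<forall>z. norm (z - \<omega> u) < d \<longrightarrow> norm (H z - H (\<omega> u)) \<le> e"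
proof -
  have "bounded (\<omega> ` {0..T})"
    by (intro compact_imp_bounded compact_continuous_image continuous_path) simp
  then obtain B where B: "\<And>u. u \<in> {0..T} \<Longrightarrow> norm (\<omega> u) \<le> B"
    unfolding bounded_iff by (meson imageI)
  have "uniformly_continuous_on (cball 0 (B + 1)) H"
    by (intro compact_uniformly_continuous continuous_on_subset[OF H]) auto
  then obtain d where d: "d > 0" "\<And>x y. x \<in> cball 0 (B + 1) \<Longrightarrow> y \<in> cball 0 (B + 1) \<Longrightarrow>
      dist x y < d \<Longrightarrow> dist (H x) (H y) < e"
    using e unfolding uniformly_continuous_on_def by metis
  have "norm (H z - H (\<omega> u)) \<le> e" if "u \<in> {0..T}" "norm (z - \<omega> u) < min d 1" for u z
    using d(2)[of z "\<omega> u"] B[OF that(1)] that(2) norm_triangle_sub[of z "\<omega> u"]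
    by (simp add: dist_norm)
  then show ?thesis using d(1) by (intro exI[of _ "min d 1"]) auto
qed

lemma stop_in_range:
  assumes "t \<in> {0..T}" "k \<le> m n"
  shows "\<exists>u\<in>{0..T}. stop t n k = \<omega> u"
  using tau_in[OF assms(2)] assms(1) by (auto simp: stop_def min_def)

text \<open>When \<open>t\<close> falls inside an interval, the stopped increment ends at
  \<open>t\<close> and not at a partition point; the oscillation covers this because it ranges over
  all times of the interval.\<close>

lemma stop_small:
  assumes "e > 0"
  shows "\<forall>\<^sub>F n in sequentially. \<forall>k<m n. norm (stop t n (Suc k) - stop t n k) < e"
  using osc_small[OF assms]
proof eventually_elim
  case (elim n)
  show ?case
  proof (intro allI impI)
    fix k assume k: "k < m n"
    then have le: "\<tau> n k \<le> \<tau> n (Suc k)" by (intro tau_mono) auto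
    show "norm (stop t n (Suc k) - stop t n k) < e"
    proof (cases "t \<le> \<tau> n k")
      case True
      then show ?thesis using le assms by (simp add: stop_def min_absorb2)
    next
      case False
      then have "min (\<tau> n (Suc k)) t \<in> {\<tau> n k..\<tau> n (Suc k)}" "min (\<tau> n k) t = \<tau> n k"
        using le by auto
      then show ?thesis unfolding stop_def using elim k by metis
    qed
  qed
qed

lemma stop_straddle_card: "card {k. k < m n \<and> \<tau> n k < t \<and> t < \<tau> n (Suc k)} \<le> 1"
proof -
  have "j = k" if "j < m n" "\<tau> n j < t" "t < \<tau> n (Suc j)" "k < m n" "\<tau> n k < t" "t < \<tau> n (Suc k)"
    for j k
    using that tau_mono[of "Suc j" k n] tau_mono[of "Suc k" j n] by linarith
  then show ?thesis by (auto simp: card_le_Suc0_iff_eq)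
qed

text \<open>Completed intervals contribute equally to both sums, and intervals starting at or after
  \<open>t\<close> contribute nothing, as the quadratic bound makes \<open>\<Phi>\<close> vanish on
  the diagonal of the path. Only an interval with \<open>t\<close> in its interior remains; there is
  at most one, and its increment tends to zero.\<close>

lemma stopped_sum_tendsto:
  assumes C: "C \<ge> 0" and t: "t \<in> {0..T}"
    and \<Phi>: "\<And>u v. u \<in> {0..T} \<Longrightarrow> v \<in> {0..T} \<Longrightarrow> \<bar>\<Phi> (\<omega> u) (\<omega> v)\<bar> \<le> C * (norm (\<omega> v - \<omega> u))\<^sup>2"
  shows "(\<lambda>n. (\<Sum>k<m n. \<Phi> (stop t n k) (stop t n (Suc k)))
      - (\<Sum>k\<in>idx n t. \<Phi> (\<omega> (\<tau> n k)) (\<omega> (\<tau> n (Suc k))))) \<longlonglongrightarrow> (0::real)"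
proof (rule tendsto_zero_if_eventually_le)
  fix e :: real assume e: "e > 0"
  \<comment> \<open>Chosen so that \<open>C * d\<^sup>2 \<le> e\<close>; the denominator
    \<open>C + 1\<close> stays positive when \<open>C = 0\<close>.\<close>
  define d where "d = sqrt (e / (C + 1))"
  have d: "d > 0" using e C by (simp add: d_def)
  have "C * d\<^sup>2 = e * (C / (C + 1))" using e C by (simp add: d_def)
  also have "\<dots> \<le> e * 1" using e C by (intro mult_left_mono) auto
  finally have Cd: "C * d\<^sup>2 \<le> e" by simp
  show "\<forall>\<^sub>F n in sequentially. \<bar>(\<Sum>k<m n. \<Phi> (stop t n k) (stop t n (Suc k)))
      - (\<Sum>k\<in>idx n t. \<Phi> (\<omega> (\<tau> n k)) (\<omega> (\<tau> n (Suc k))))\<bar> \<le> e"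
    using stop_small[OF d, of t]
  proof eventually_elim
    case (elim n)
    let ?P = "\<lambda>k. \<Phi> (stop t n k) (stop t n (Suc k))"
    define Z where "Z = {k. k < m n \<and> \<tau> n k < t \<and> t < \<tau> n (Suc k)}"
    have "(\<Sum>k\<in>idx n t. \<Phi> (\<omega> (\<tau> n k)) (\<omega> (\<tau> n (Suc k)))) = (\<Sum>k\<in>idx n t. ?P k)"
    proof (intro sum.cong refl)
      fix k assume k: "k \<in> idx n t"
      then have "\<tau> n k \<le> \<tau> n (Suc k)" by (intro tau_mono) (auto simp: idx_def)
      then show "\<Phi> (\<omega> (\<tau> n k)) (\<omega> (\<tau> n (Suc k))) = ?P k"
        using k by (simp add: idx_def stop_def min_absorb1)
    qed
    then have "(\<Sum>k<m n. ?P k) - (\<Sum>k\<in>idx n t. \<Phi> (\<omega> (\<tau> n k)) (\<omega> (\<tau> n (Suc k))))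
        = (\<Sum>k\<in>{..<m n} - idx n t. ?P k)"
      by (subst sum_diff) (auto simp: idx_def)
    also have "\<dots> = (\<Sum>k\<in>Z. ?P k)"
    proof (rule sum.mono_neutral_right)
      show "\<forall>k\<in>{..<m n} - idx n t - Z. ?P k = 0"
      proof
        fix k assume "k \<in> {..<m n} - idx n t - Z"
        then have k: "k < m n" "\<tau> n k \<ge> t" "\<tau> n (Suc k) > t" by (auto simp: Z_def idx_def)
        then have "stop t n (Suc k) = \<omega> t" "stop t n k = \<omega> t" by (auto simp: stop_def min_absorb2)
        with \<Phi>[OF t t] show "?P k = 0" by simp
      qed
    qed (auto simp: Z_def idx_def)
    finally have *: "(\<Sum>k<m n. ?P k) - (\<Sum>k\<in>idx n t. \<Phi> (\<omega> (\<tau> n k)) (\<omega> (\<tau> n (Suc k))))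
      = (\<Sum>k\<in>Z. ?P k)" .
    have "\<bar>\<Sum>k\<in>Z. ?P k\<bar> \<le> (\<Sum>k\<in>Z. C * d\<^sup>2)"
    proof (intro order_trans[OF sum_abs] sum_mono)
      fix k assume "k \<in> Z"
      then have k: "k < m n" by (simp add: Z_def)
      obtain u v where "u \<in> {0..T}" "stop t n k = \<omega> u" "v \<in> {0..T}" "stop t n (Suc k) = \<omega> v"
        using stop_in_range[OF t, of k n] stop_in_range[OF t, of "Suc k" n] k by auto
      then have "\<bar>?P k\<bar> \<le> C * (norm (stop t n (Suc k) - stop t n k))\<^sup>2" using \<Phi> by simp
      also have "\<dots> \<le> C * d\<^sup>2"
        using elim k C by (intro mult_left_mono power_mono) (auto intro: less_imp_le)
      finally show "\<bar>?P k\<bar> \<le> C * d\<^sup>2" .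
    qed
    also have "\<dots> = real (card Z) * (C * d\<^sup>2)" by simp
    also have "\<dots> \<le> 1 * (C * d\<^sup>2)"
      using stop_straddle_card[of n t] C by (intro mult_right_mono) (auto simp: Z_def)
    also have "\<dots> \<le> e" using Cd by simp
    finally show ?case unfolding * .
  qed
qed

definition quad_sum :: "(real ^ 'd \<Rightarrow> real ^ 'd ^ 'd) \<Rightarrow> real \<Rightarrow> nat \<Rightarrow> real" where
  "quad_sum H t n = (\<Sum>i\<in>idx n t. quad H (\<omega> (\<tau> n i)) (\<omega> (\<tau> n (Suc i))))"

text \<open>For continuous \<open>H\<close> this plays the role of the integral of \<open>H\<close>
  along the path against its matrix-valued quadratic variation.\<close>

definition quad_lim :: "(real ^ 'd \<Rightarrow> real ^ 'd ^ 'd) \<Rightarrow> real \<Rightarrow> real" where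
  "quad_lim H t = lim (quad_sum H t)"

lemma quad_sum_tendsto:
  assumes "continuous_on UNIV H" "t \<in> {0..T}"
  shows "quad_sum H t \<longlonglongrightarrow> quad_lim H t"
  using quad_sum_convergent[OF assms] unfolding quad_lim_def quad_sum_def
  by (simp add: convergent_LIMSEQ_iff)

lemma quad_lim_diff:
  assumes "continuous_on UNIV H" "continuous_on UNIV K" "t \<in> {0..T}"
  shows "quad_lim (\<lambda>x. H x - K x) t = quad_lim H t - quad_lim K t"
proof -
  have "quad_sum (\<lambda>x. H x - K x) t = (\<lambda>n. quad_sum H t n - quad_sum K t n)"
    by (simp add: quad_sum_def quad_diff sum_subtractf fun_eq_iff)
  with assms show ?thesis
    unfolding quad_lim_def[of "\<lambda>x. H x - K x"] by (auto intro!: limI tendsto_diff quad_sum_tendsto)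
qed

lemma quad_stopped_sum_tendsto:
  assumes H: "continuous_on UNIV H" and t: "t \<in> {0..T}"
  shows "(\<lambda>n. \<Sum>k<m n. quad H (stop t n k) (stop t n (Suc k))) \<longlonglongrightarrow> quad_lim H t"
proof -
  have "compact ((\<lambda>u. H (\<omega> u)) ` {0..T})"
    by (intro compact_continuous_image continuous_on_compose2[OF H continuous_path]) auto
  then have "bounded ((\<lambda>u. H (\<omega> u)) ` {0..T})" by (rule compact_imp_bounded)
  then obtain C where C: "C > 0" "\<And>u. u \<in> {0..T} \<Longrightarrow> norm (H (\<omega> u)) \<le> C"
    unfolding bounded_pos by (meson imageI)
  have "(\<lambda>n. (\<Sum>k<m n. quad H (stop t n k) (stop t n (Suc k))) - quad_sum H t n) \<longlonglongrightarrow> 0"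
    unfolding quad_sum_def
  proof (rule stopped_sum_tendsto[OF less_imp_le[OF C(1)] t])
    fix u v assume "u \<in> {0..T}" "v \<in> {0..T}"
    then show "\<bar>quad H (\<omega> u) (\<omega> v)\<bar> \<le> C * (norm (\<omega> v - \<omega> u))\<^sup>2"
      by (intro order_trans[OF abs_quad_le] mult_right_mono C(2)) auto
  qed
  from tendsto_add[OF this quad_sum_tendsto[OF H t]] show ?thesis by simp
qed

text \<open>The identity matrix turns quadratic sums into sums of squared increments, whose
  convergence gives the bounds used for error terms.\<close>

lemma quad_mat_1: "quad (\<lambda>_. mat 1) x y = (norm (y - x))\<^sup>2"
  by (simp add: quad_def dot_square_norm)

text \<open>Taylor remainders are of smaller order than the squared increment, uniformly along the
  path, and the sums of squared stopped increments are bounded because they converge.\<close>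

lemma stopped_sum_small_tendsto:
  assumes t: "t \<in> {0..T}"
    and \<Psi>: "\<And>e. e > 0 \<Longrightarrow> \<exists>d>0. \<forall>u\<in>{0..T}. \<forall>y. norm (y - \<omega> u) < d \<longrightarrow>
      \<bar>\<Psi> (\<omega> u) y\<bar> \<le> e * (norm (y - \<omega> u))\<^sup>2"
  shows "(\<lambda>n. \<Sum>k<m n. \<Psi> (stop t n k) (stop t n (Suc k))) \<longlonglongrightarrow> (0::real)"
proof (rule tendsto_zero_if_eventually_le)
  fix e :: real assume e: "e > 0"
  let ?N = "\<lambda>n k. (norm (stop t n (Suc k) - stop t n k))\<^sup>2"
  have "(\<lambda>n. \<Sum>k<m n. ?N n k) \<longlonglongrightarrow> quad_lim (\<lambda>_. mat 1) t"
    using quad_stopped_sum_tendsto[of "\<lambda>_. mat 1" t] t by (simp add: quad_mat_1)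
  then have "Bseq (\<lambda>n. \<Sum>k<m n. ?N n k)"
    by (intro convergent_imp_Bseq convergentI)
  then obtain M where M: "M > 0" "\<And>n. norm (\<Sum>k<m n. ?N n k) \<le> M" by (auto elim!: BseqE)
  obtain d where d: "d > 0" "\<And>u y. u \<in> {0..T} \<Longrightarrow> norm (y - \<omega> u) < d \<Longrightarrow>
      \<bar>\<Psi> (\<omega> u) y\<bar> \<le> e / M * (norm (y - \<omega> u))\<^sup>2"
    using \<Psi>[of "e / M"] e M by auto
  show "\<forall>\<^sub>F n in sequentially. \<bar>\<Sum>k<m n. \<Psi> (stop t n k) (stop t n (Suc k))\<bar> \<le> e"
    using stop_small[OF d(1), of t]
  proof eventually_elim
    case (elim n)
    have "\<bar>\<Sum>k<m n. \<Psi> (stop t n k) (stop t n (Suc k))\<bar> \<le> (\<Sum>k<m n. e / M * ?N n k)"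
    proof (intro order_trans[OF sum_abs] sum_mono)
      fix k assume "k \<in> {..<m n}"
      then have k: "k < m n" by simp
      then obtain u where "u \<in> {0..T}" "stop t n k = \<omega> u"
        using stop_in_range[OF t, of k n] by auto
      then show "\<bar>\<Psi> (stop t n k) (stop t n (Suc k))\<bar> \<le> e / M * ?N n k"
        using d(2)[of u "stop t n (Suc k)"] elim[rule_format, OF k] by simp
    qed
    also have "\<dots> = e / M * (\<Sum>k<m n. ?N n k)" by (simp only: sum_distrib_left)
    also have "\<dots> \<le> e / M * M" using M(2)[of n] M(1) e by (intro mult_left_mono) auto
    finally show ?case using M by simp
  qed
qed

lemma hess_near_path:
  assumes f: "C_k 2 f" and e: "e > 0"
  shows "\<exists>d>0. \<forall>u\<in>{0..T}. \<forall>y. norm (y - \<omega> u) < d \<longrightarrow>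
    (\<forall>z\<in>closed_segment (\<omega> u) y. norm (hess f z - hess f (\<omega> u)) \<le> e)"
proof -
  obtain d where d: "d > 0"
    "\<And>u z. u \<in> {0..T} \<Longrightarrow> norm (z - \<omega> u) < d \<Longrightarrow> norm (hess f z - hess f (\<omega> u)) \<le> e"
    using path_locally_uniform[OF C_2_continuous_hess[OF f] e] by blast
  have "norm (hess f z - hess f (\<omega> u)) \<le> e"
    if "u \<in> {0..T}" "norm (y - \<omega> u) < d" "z \<in> closed_segment (\<omega> u) y" for u y z
    using segment_bound(1)[OF that(3)] that d(2) by (meson le_less_trans)
  with d(1) show ?thesis by blast
qed

lemma covariation_sum_tendsto:
  assumes f: "C_k 2 f" and t: "t \<in> {0..T}"
  shows "covariation_sum m \<tau> \<omega> f t \<longlonglongrightarrow> quad_lim (hess f) t"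
proof -
  have "(\<lambda>n. \<Sum>k<m n. (\<lambda>x y. (grad f y - grad f x) \<bullet> (y - x) - quad (hess f) x y)
      (stop t n k) (stop t n (Suc k))) \<longlonglongrightarrow> 0"
    by (rule stopped_sum_small_tendsto[OF t]) (use C_2_Taylor(2)[OF f] hess_near_path[OF f] in meson)
  then have "(\<lambda>n. covariation_sum m \<tau> \<omega> f t n
      - (\<Sum>k<m n. quad (hess f) (stop t n k) (stop t n (Suc k)))) \<longlonglongrightarrow> 0"
    by (simp add: covariation_sum_def stop_def sum_subtractf)
  from tendsto_add[OF this quad_stopped_sum_tendsto[OF C_2_continuous_hess[OF f] t]]
  show ?thesis by simp
qed

text \<open>The increments of \<open>f\<close> along the stopped points telescope to the same value
  for every \<open>n\<close>. Taylor's formula then transfers convergence from the quadratic sums to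
  the integral sums.\<close>

lemma integral_sum_tendsto:
  assumes f: "C_k 2 f" and t: "t \<in> {0..T}"
  shows "integral_sum m \<tau> \<omega> f t \<longlonglongrightarrow> f (\<omega> t) - f (\<omega> 0) - quad_lim (hess f) t / 2"
proof -
  let ?Q = "\<lambda>n. \<Sum>k<m n. quad (hess f) (stop t n k) (stop t n (Suc k))"
  \<comment> \<open>The gradient is evaluated at the unstopped point in \<open>integral_sum\<close>;
    the two points differ only after \<open>t\<close>, where the stopped increment is zero.\<close>
  have int: "integral_sum m \<tau> \<omega> f t n
      = (\<Sum>k<m n. grad f (stop t n k) \<bullet> (stop t n (Suc k) - stop t n k))" for n
    unfolding integral_sum_def
  proof (intro sum.cong refl)
    fix k assume "k \<in> {..<m n}"
    then have le: "\<tau> n k \<le> \<tau> n (Suc k)" by (intro tau_mono) auto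
    show "grad f (\<omega> (\<tau> n k)) \<bullet> (\<omega> (min (\<tau> n (Suc k)) t) - \<omega> (min (\<tau> n k) t))
        = grad f (stop t n k) \<bullet> (stop t n (Suc k) - stop t n k)"
    proof (cases "\<tau> n k \<le> t")
      case True
      then show ?thesis by (simp add: stop_def min_absorb1)
    next
      case False
      then have "min (\<tau> n k) t = t" "min (\<tau> n (Suc k)) t = t" using le by auto
      then show ?thesis by (simp add: stop_def)
    qed
  qed
  have tele: "(\<Sum>k<m n. f (stop t n (Suc k)) - f (stop t n k)) = f (\<omega> t) - f (\<omega> 0)" for n
    using sum_lessThan_telescope[of "\<lambda>k. f (stop t n k)" "m n"] t
    by (simp add: stop_def min_absorb2)
  have "(\<lambda>n. \<Sum>k<m n. (\<lambda>x y. f y - f x - grad f x \<bullet> (y - x) - quad (hess f) x y / 2)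
      (stop t n k) (stop t n (Suc k))) \<longlonglongrightarrow> 0"
    by (rule stopped_sum_small_tendsto[OF t]) (use C_2_Taylor(1)[OF f] hess_near_path[OF f] in meson)
  moreover have "f (\<omega> t) - f (\<omega> 0) - integral_sum m \<tau> \<omega> f t n - ?Q n / 2 = (\<Sum>k<m n.
      (\<lambda>x y. f y - f x - grad f x \<bullet> (y - x) - quad (hess f) x y / 2) (stop t n k) (stop t n (Suc k)))" for n
    unfolding int tele[of n, symmetric] by (simp only: sum_subtractf sum_divide_distrib)
  ultimately have lim: "(\<lambda>n. f (\<omega> t) - f (\<omega> 0) - integral_sum m \<tau> \<omega> f t n - ?Q n / 2) \<longlonglongrightarrow> 0"
    by presburger
  \<comment> \<open>The Taylor identity is solved for the integral sum.\<close>
  have "(\<lambda>n. f (\<omega> t) - f (\<omega> 0) - ?Q n / 2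
      - (f (\<omega> t) - f (\<omega> 0) - integral_sum m \<tau> \<omega> f t n - ?Q n / 2))
      \<longlonglongrightarrow> f (\<omega> t) - f (\<omega> 0) - quad_lim (hess f) t / 2 - 0"
    by (intro tendsto_diff tendsto_const tendsto_divide lim
        quad_stopped_sum_tendsto[OF C_2_continuous_hess[OF f] t]) auto
  then show ?thesis by simp
qed

end

section \<open>Quadratic limits bounded by the occupation seminorm\<close>

lemma occ_density_nonneg: "0 \<le> occ_density m \<tau> \<omega> n x"
  unfolding occ_density_def by (intro sum_nonneg segment_density_nonneg)

lemma occ_density_measurable: "occ_density m \<tau> \<omega> n \<in> borel_measurable lebesgue"
  unfolding occ_density_def by (intro borel_measurable_sum segment_density_measurable)

text \<open>A strict bound on an upper limit holds eventually for the integrals themselves, so the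
  triangle inequality can be applied at each fixed large \<open>n\<close>.\<close>

lemma W0_norm_less_diff:
  fixes f g :: "real ^ 'd \<Rightarrow> 'b :: euclidean_space"
  assumes f: "f \<in> borel_measurable lebesgue" and g: "g \<in> borel_measurable lebesgue"
    and "W0_norm m \<tau> \<omega> f < ennreal a" "W0_norm m \<tau> \<omega> g < ennreal b" "a \<ge> 0" "b \<ge> 0"
  shows "\<forall>\<^sub>F n in sequentially.
    (\<integral>\<^sup>+ x. ennreal (norm (f x - g x) * occ_density m \<tau> \<omega> n x) \<partial>lebesgue) < ennreal (a + b)"
proof -
  note [measurable] = f g occ_density_measurable
  have "\<forall>\<^sub>F n in sequentially. (\<integral>\<^sup>+ x. ennreal (norm (f x) * occ_density m \<tau> \<omega> n x) \<partial>lebesgue) < ennreal a"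
    "\<forall>\<^sub>F n in sequentially. (\<integral>\<^sup>+ x. ennreal (norm (g x) * occ_density m \<tau> \<omega> n x) \<partial>lebesgue) < ennreal b"
    using assms unfolding W0_norm_def by (auto dest: Limsup_lessD)
  then show ?thesis
  proof eventually_elim
    case (elim n)
    have "(\<integral>\<^sup>+ x. ennreal (norm (f x - g x) * occ_density m \<tau> \<omega> n x) \<partial>lebesgue)
      \<le> (\<integral>\<^sup>+ x. ennreal (norm (f x) * occ_density m \<tau> \<omega> n x)
            + ennreal (norm (g x) * occ_density m \<tau> \<omega> n x) \<partial>lebesgue)"
    proof (rule nn_integral_mono)
      fix x
      have "norm (f x - g x) * occ_density m \<tau> \<omega> n x
          \<le> (norm (f x) + norm (g x)) * occ_density m \<tau> \<omega> n x"
        by (intro mult_right_mono norm_triangle_ineq4 occ_density_nonneg)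
      then show "ennreal (norm (f x - g x) * occ_density m \<tau> \<omega> n x)
          \<le> ennreal (norm (f x) * occ_density m \<tau> \<omega> n x)
            + ennreal (norm (g x) * occ_density m \<tau> \<omega> n x)"
        by (simp add: distrib_right occ_density_nonneg ennreal_leI flip: ennreal_plus)
    qed
    also have "\<dots> = (\<integral>\<^sup>+ x. ennreal (norm (f x) * occ_density m \<tau> \<omega> n x) \<partial>lebesgue)
        + (\<integral>\<^sup>+ x. ennreal (norm (g x) * occ_density m \<tau> \<omega> n x) \<partial>lebesgue)"
      by (rule nn_integral_add) measurable
    also have "\<dots> < ennreal a + ennreal b"
      using elim by (rule add_strict_mono)
    finally show ?case using assms by simp
  qed
qed

lemma continuous_imp_borel_measurable_lebesgue:
  fixes f :: "'a :: euclidean_space \<Rightarrow> 'b :: topological_space"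
  assumes "continuous_on UNIV f"
  shows "f \<in> borel_measurable lebesgue"
proof -
  have "f \<in> borel_measurable lborel"
    using borel_measurable_continuous_onI[OF assms] by simp
  then show ?thesis by (rule measurable_completion)
qed

lemma weak_hess_measurable:
  assumes "sobolev_W21 F"
  shows "weak_hess F \<in> borel_measurable lebesgue"
proof -
  have "\<exists>H. integrable lebesgue H \<and> has_weak_hess F H"
    using assms by (simp add: sobolev_W21_def)
  then have "integrable lebesgue (weak_hess F)"
    unfolding weak_hess_def by (rule someI2_ex) simp
  then show ?thesis by simp
qed

context qv_path begin

text \<open>On the support of a segment density \<open>norm (H x)\<close> is at least its value at
  the left endpoint minus \<open>e\<close>, and the mass of the density dominates a multiple of the
  squared increment. Summing bounds the quadratic sum by the integral plus \<open>e\<close> times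
  the sum of squared increments.\<close>

lemma quad_lim_le:
  assumes H: "continuous_on UNIV H" and t: "t \<in> {0..T}" and a: "a \<ge> 0"
    and int: "\<forall>\<^sub>F n in sequentially.
      (\<integral>\<^sup>+ x. ennreal (norm (H x) * occ_density m \<tau> \<omega> n x) \<partial>lebesgue) < ennreal a"
  shows "\<bar>quad_lim H t\<bar> \<le> a / (2 / 2 ^ CARD('d))"
proof -
  define c where "c = (2 / 2 ^ CARD('d) :: real)"
  have c: "c > 0" by (simp add: c_def)
  note [measurable] = continuous_imp_borel_measurable_lebesgue[OF H] segment_density_measurable
  let ?D = "\<lambda>n i. (norm (\<omega> (\<tau> n (Suc i)) - \<omega> (\<tau> n i)))\<^sup>2"
  have lim1: "(\<lambda>n. \<Sum>i\<in>idx n t. ?D n i) \<longlonglongrightarrow> quad_lim (\<lambda>_. mat 1) t"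
    using quad_sum_tendsto[of "\<lambda>_. mat 1" t] t unfolding quad_sum_def quad_mat_1 by simp
  have "\<bar>quad_lim H t\<bar> \<le> a / c + e * quad_lim (\<lambda>_. mat 1) t" if e: "e > 0" for e
  proof (rule tendsto_le[OF sequentially_bot])
    show "(\<lambda>n. \<bar>quad_sum H t n\<bar>) \<longlonglongrightarrow> \<bar>quad_lim H t\<bar>"
      by (intro tendsto_rabs quad_sum_tendsto H t)
    show "(\<lambda>n. a / c + e * (\<Sum>i\<in>idx n t. ?D n i)) \<longlonglongrightarrow> a / c + e * quad_lim (\<lambda>_. mat 1) t"
      by (intro tendsto_intros lim1)
    obtain d where d: "d > 0"
      "\<And>u z. u \<in> {0..T} \<Longrightarrow> norm (z - \<omega> u) < d \<Longrightarrow> norm (H z - H (\<omega> u)) \<le> e"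
      using path_locally_uniform[OF H e] by blast
    show "\<forall>\<^sub>F n in sequentially. \<bar>quad_sum H t n\<bar> \<le> a / c + e * (\<Sum>i\<in>idx n t. ?D n i)"
      using osc_small[OF d(1)] int
    proof eventually_elim
      case (elim n)
      \<comment> \<open>Cut off at \<open>0\<close> because the mass bound requires a nonnegative
        constant; adding \<open>e\<close> still dominates the norm.\<close>
      define h where "h i = max 0 (norm (H (\<omega> (\<tau> n i))) - e)" for i
      let ?s = "\<lambda>i. segment_density (\<omega> (\<tau> n i)) (\<omega> (\<tau> n (Suc i)))"
      have mass: "ennreal (h i * (c * ?D n i)) \<le> (\<integral>\<^sup>+ x. ennreal (norm (H x) * ?s i x) \<partial>lebesgue)"
        if i: "i < m n" for i
        unfolding c_def
      proof (rule segment_density_mass)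
        show "h i \<ge> 0" by (simp add: h_def)
        fix x assume x: "x \<in> cball ((1/2) *\<^sub>R (\<omega> (\<tau> n i) + \<omega> (\<tau> n (Suc i))))
            ((1/2) * norm (\<omega> (\<tau> n (Suc i)) - \<omega> (\<tau> n i)))"
        have "norm (\<omega> (\<tau> n (Suc i)) - \<omega> (\<tau> n i)) < d"
          using elim(1) i tau_mono[of i "Suc i" n] by auto
        then have "norm (x - \<omega> (\<tau> n i)) < d"
          using norm_le_if_in_diameter_cball[OF x] by linarith
        then have "norm (H x - H (\<omega> (\<tau> n i))) \<le> e"
          using d(2) tau_in[of i n] i by auto
        then show "h i \<le> norm (H x)"
          using norm_triangle_ineq2[of "H (\<omega> (\<tau> n i))" "H x"] norm_minus_commute[of "H x"]
          by (auto simp: h_def)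
      qed
      have "ennreal (\<Sum>i<m n. h i * (c * ?D n i)) = (\<Sum>i<m n. ennreal (h i * (c * ?D n i)))"
        using c by (subst sum_ennreal) (auto simp: h_def)
      also have "\<dots> \<le> (\<Sum>i<m n. \<integral>\<^sup>+ x. ennreal (norm (H x) * ?s i x) \<partial>lebesgue)"
        by (intro sum_mono mass) simp
      also have "\<dots> = (\<integral>\<^sup>+ x. (\<Sum>i<m n. ennreal (norm (H x) * ?s i x)) \<partial>lebesgue)"
        by (rule nn_integral_sum[symmetric]) measurable
      also have "\<dots> = (\<integral>\<^sup>+ x. ennreal (norm (H x) * occ_density m \<tau> \<omega> n x) \<partial>lebesgue)"
        by (simp add: occ_density_def sum_distrib_left segment_density_nonneg sum_ennreal)
      also have "\<dots> < ennreal a" by (rule elim)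
      finally have "(\<Sum>i<m n. h i * (c * ?D n i)) \<le> a"
        using a by (simp add: ennreal_less_iff c sum_nonneg h_def less_imp_le)
      moreover have "(\<Sum>i<m n. h i * (c * ?D n i)) = c * (\<Sum>i<m n. h i * ?D n i)"
        by (simp add: sum_distrib_left mult_ac)
      ultimately have ha: "(\<Sum>i<m n. h i * ?D n i) \<le> a / c"
        using c by (simp add: pos_le_divide_eq mult.commute)
      have "\<bar>quad_sum H t n\<bar> \<le> (\<Sum>i\<in>idx n t. h i * ?D n i + e * ?D n i)"
        unfolding quad_sum_def
      proof (intro order_trans[OF sum_abs] sum_mono order_trans[OF abs_quad_le])
        fix i
        show "norm (H (\<omega> (\<tau> n i))) * ?D n i \<le> h i * ?D n i + e * ?D n i"
          unfolding distrib_right[symmetric] by (intro mult_right_mono) (auto simp: h_def)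
      qed
      also have "\<dots> = (\<Sum>i\<in>idx n t. h i * ?D n i) + e * (\<Sum>i\<in>idx n t. ?D n i)"
        by (simp add: sum.distrib sum_distrib_left)
      \<comment> \<open>The occupation density sees the whole of \<open>{0..T}\<close>; nonnegative
        terms allow passing from the intervals completed by \<open>t\<close> to all of them.\<close>
      also have "(\<Sum>i\<in>idx n t. h i * ?D n i) \<le> (\<Sum>i<m n. h i * ?D n i)"
        by (intro sum_mono2) (auto simp: idx_def h_def)
      finally show ?case using ha by simp
    qed
  qed
  \<comment> \<open>The limit of the squared increments does not depend on \<open>e\<close>, so the
    error vanishes as \<open>e\<close> tends to zero.\<close>
  then have "\<forall>\<^sub>F e in at_right 0. \<bar>quad_lim H t\<bar> \<le> a / c + e * quad_lim (\<lambda>_. mat 1) t"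
    by (auto simp: eventually_at_right_field intro: exI[of _ 1])
  moreover have "((\<lambda>e. a / c + e * quad_lim (\<lambda>_. mat 1) t) \<longlongrightarrow> a / c + 0 * quad_lim (\<lambda>_. mat 1) t) (at_right 0)"
    by (intro tendsto_intros)
  ultimately have "\<bar>quad_lim H t\<bar> \<le> a / c + 0 * quad_lim (\<lambda>_. mat 1) t"
    by (intro tendsto_lowerbound) auto
  then show ?thesis by (simp add: c_def)
qed

section \<open>Passage from smooth approximations to \<open>F\<close>\<close>

text \<open>The weak Hessian of \<open>F\<close> cancels in the difference of the two errors,
  leaving a continuous field to which \<open>quad_lim_le\<close> applies. Equal sequences give the
  Cauchy property, different ones the independence of the choice.\<close>

lemma W2_approx_quad_lim_diff:
  assumes F: "sobolev_W21 F" and Fs: "W2_approx T m \<tau> \<omega> F Fs" and Gs: "W2_approx T m \<tau> \<omega> F Gs"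
    and t: "t \<in> {0..T}" and e: "e > 0"
  shows "\<exists>N. \<forall>j\<ge>N. \<forall>k\<ge>N. \<bar>quad_lim (hess (Fs j)) t - quad_lim (hess (Gs k)) t\<bar> \<le> e"
proof -
  define c where "c = (2 / 2 ^ CARD('d) :: real)"
  \<comment> \<open>Each of the two seminorms contributes \<open>a\<close>, and
    \<open>(a + a) / c = e\<close>.\<close>
  define a where "a = e * c / 2"
  have a: "a > 0" using e by (simp add: a_def c_def)
  have cont: "continuous_on UNIV (hess (Fs k))" "continuous_on UNIV (hess (Gs k))" for k
    using Fs Gs by (auto simp: W2_approx_def C2_b_def intro: C_2_continuous_hess)
  have "\<forall>\<^sub>F k in sequentially. W0_norm m \<tau> \<omega> (\<lambda>x. hess (Fs k) x - weak_hess F x) < ennreal a"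
    "\<forall>\<^sub>F k in sequentially. W0_norm m \<tau> \<omega> (\<lambda>x. hess (Gs k) x - weak_hess F x) < ennreal a"
    using Fs Gs a unfolding W2_approx_def by (auto elim!: order_tendstoD)
  then have "\<forall>\<^sub>F k in sequentially. W0_norm m \<tau> \<omega> (\<lambda>x. hess (Fs k) x - weak_hess F x) < ennreal a
    \<and> W0_norm m \<tau> \<omega> (\<lambda>x. hess (Gs k) x - weak_hess F x) < ennreal a"
    by (rule eventually_conj)
  then obtain N where N: "\<And>k. k \<ge> N \<Longrightarrow>
      W0_norm m \<tau> \<omega> (\<lambda>x. hess (Fs k) x - weak_hess F x) < ennreal a \<and>
      W0_norm m \<tau> \<omega> (\<lambda>x. hess (Gs k) x - weak_hess F x) < ennreal a"
    by (auto simp: eventually_sequentially)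
  have "\<bar>quad_lim (hess (Fs j)) t - quad_lim (hess (Gs k)) t\<bar> \<le> e" if "j \<ge> N" "k \<ge> N" for j k
  proof -
    have "\<forall>\<^sub>F n in sequentially. (\<integral>\<^sup>+ x. ennreal (norm
        ((hess (Fs j) x - weak_hess F x) - (hess (Gs k) x - weak_hess F x))
        * occ_density m \<tau> \<omega> n x) \<partial>lebesgue) < ennreal (a + a)"
      using N[OF that(1)] N[OF that(2)] a
      by (intro W0_norm_less_diff borel_measurable_diff weak_hess_measurable F
          continuous_imp_borel_measurable_lebesgue cont) auto
    then have "\<bar>quad_lim (\<lambda>x. hess (Fs j) x - hess (Gs k) x) t\<bar> \<le> (a + a) / c"
      unfolding c_def using a t by (intro quad_lim_le continuous_on_diff cont) auto
    also have "(a + a) / c = e" by (simp add: a_def c_def)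
    finally show ?thesis unfolding quad_lim_diff[OF cont t] .
  qed
  then show ?thesis by blast
qed

lemma W2_approx_quad_lim_convergent:
  assumes F: "sobolev_W21 F" and Fs: "W2_approx T m \<tau> \<omega> F Fs" and t: "t \<in> {0..T}"
  shows "convergent (\<lambda>k. quad_lim (hess (Fs k)) t)"
proof -
  have "Cauchy (\<lambda>k. quad_lim (hess (Fs k)) t)"
  proof (rule metric_CauchyI)
    fix e :: real assume e: "e > 0"
    then obtain N where "\<forall>j\<ge>N. \<forall>k\<ge>N. \<bar>quad_lim (hess (Fs j)) t - quad_lim (hess (Fs k)) t\<bar> \<le> e / 2"
      using W2_approx_quad_lim_diff[OF F Fs Fs t, of "e / 2"] by auto
    moreover have "e / 2 < e" using e by simp
    ultimately show "\<exists>N. \<forall>j\<ge>N. \<forall>k\<ge>N. dist (quad_lim (hess (Fs j)) t) (quad_lim (hess (Fs k)) t) < e"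
      unfolding dist_real_def by (meson le_less_trans)
  qed
  then show ?thesis by (simp add: Cauchy_convergent_iff)
qed

lemma W2_approx_quad_lim_unique:
  assumes F: "sobolev_W21 F" and Fs: "W2_approx T m \<tau> \<omega> F Fs" and Gs: "W2_approx T m \<tau> \<omega> F Gs"
    and t: "t \<in> {0..T}" and lim: "(\<lambda>k. quad_lim (hess (Gs k)) t) \<longlonglongrightarrow> q"
  shows "(\<lambda>k. quad_lim (hess (Fs k)) t) \<longlonglongrightarrow> q"
proof -
  have "(\<lambda>k. quad_lim (hess (Fs k)) t - quad_lim (hess (Gs k)) t) \<longlonglongrightarrow> 0"
  proof (rule tendsto_zero_if_eventually_le)
    fix e :: real assume "e > 0"
    from W2_approx_quad_lim_diff[OF F Fs Gs t this]
    show "\<forall>\<^sub>F k in sequentially. \<bar>quad_lim (hess (Fs k)) t - quad_lim (hess (Gs k)) t\<bar> \<le> e"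
      by (auto simp: eventually_sequentially)
  qed
  from tendsto_add[OF this lim] show ?thesis by simp
qed

end

theorem theorem5p1:
  fixes T :: real and m :: "nat \<Rightarrow> nat" and \<tau> :: "nat \<Rightarrow> nat \<Rightarrow> real"
    and \<omega> :: "real \<Rightarrow> real ^ 'd" and F :: "real ^ 'd \<Rightarrow> real"
  assumes "T > 0"
    and "is_partition_seq T m \<tau>"
    and "vector_Q T m \<tau> \<omega>"
    and "osc m \<tau> \<omega> \<longlonglongrightarrow> 0"
    and "F \<in> W2_space T m \<tau> \<omega>"
  shows "\<exists>I Q :: real \<Rightarrow> real.
     (\<forall>Fs. W2_approx T m \<tau> \<omega> F Fs \<longrightarrow> (\<forall>t\<in>{0..T}.
        (\<forall>k. convergent (integral_sum m \<tau> \<omega> (Fs k) t) \<and>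
             convergent (covariation_sum m \<tau> \<omega> (Fs k) t)) \<and>
        (\<lambda>k. pathwise_integral m \<tau> \<omega> (Fs k) t) \<longlonglongrightarrow> I t \<and>
        (\<lambda>k. pathwise_covariation m \<tau> \<omega> (Fs k) t) \<longlonglongrightarrow> Q t)) \<and>
     (\<forall>t\<in>{0..T}.
        real_of_ereal (precise_rep F (\<omega> t)) - real_of_ereal (precise_rep F (\<omega> 0))
          = I t + 1/2 * Q t)"
proof -
  interpret qv_path T m \<tau> \<omega> using assms by unfold_locales
  obtain Gs where F: "sobolev_W21 F" and Gs: "W2_approx T m \<tau> \<omega> F Gs"
    using assms by (auto simp: W2_space_def)
  \<comment> \<open>One fixed approximating sequence defines the limit;
    \<open>W2_approx_quad_lim_unique\<close> carries it over to every other one.\<close>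
  define Q where "Q t = lim (\<lambda>k. quad_lim (hess (Gs k)) t)" for t
  define \<Delta>F where
    "\<Delta>F t = real_of_ereal (precise_rep F (\<omega> t)) - real_of_ereal (precise_rep F (\<omega> 0))" for t
  have "(\<forall>k. convergent (integral_sum m \<tau> \<omega> (Fs k) t) \<and>
             convergent (covariation_sum m \<tau> \<omega> (Fs k) t)) \<and>
        (\<lambda>k. pathwise_integral m \<tau> \<omega> (Fs k) t) \<longlonglongrightarrow> \<Delta>F t - Q t / 2 \<and>
        (\<lambda>k. pathwise_covariation m \<tau> \<omega> (Fs k) t) \<longlonglongrightarrow> Q t"
    if Fs: "W2_approx T m \<tau> \<omega> F Fs" and t: "t \<in> {0..T}" for Fs t
  proof -
    have C2: "C_k 2 (Fs k)" for k using Fs by (simp add: W2_approx_def C2_b_def)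
    note int = integral_sum_tendsto[OF C2 t] and cov = covariation_sum_tendsto[OF C2 t]
    have "(\<lambda>k. quad_lim (hess (Gs k)) t) \<longlonglongrightarrow> Q t"
      using W2_approx_quad_lim_convergent[OF F Gs t] by (simp add: Q_def convergent_LIMSEQ_iff)
    then have q: "(\<lambda>k. quad_lim (hess (Fs k)) t) \<longlonglongrightarrow> Q t"
      by (rule W2_approx_quad_lim_unique[OF F Fs Gs t])
    have "(\<lambda>k. Fs k (\<omega> s)) \<longlonglongrightarrow> real_of_ereal (precise_rep F (\<omega> s))" if "s \<in> {0..T}" for s
      using Fs that by (simp add: W2_approx_def)
    then have "(\<lambda>k. Fs k (\<omega> t) - Fs k (\<omega> 0) - quad_lim (hess (Fs k)) t / 2) \<longlonglongrightarrow> \<Delta>F t - Q t / 2"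
      unfolding \<Delta>F_def using t T by (intro tendsto_diff tendsto_divide tendsto_const q) auto
    moreover have "pathwise_integral m \<tau> \<omega> (Fs k) t
        = Fs k (\<omega> t) - Fs k (\<omega> 0) - quad_lim (hess (Fs k)) t / 2"
      "pathwise_covariation m \<tau> \<omega> (Fs k) t = quad_lim (hess (Fs k)) t" for k
      unfolding pathwise_integral_def pathwise_covariation_def using int cov by (auto intro: limI)
    ultimately show ?thesis using q convergentI[OF int] convergentI[OF cov] by simp
  qed
  \<comment> \<open>With this choice of the integral the formula for \<open>F\<close> holds
    identically; the substance is that the pathwise integrals of every approximating sequence
    converge to it.\<close>
  then show ?thesis unfolding \<Delta>F_def
    by (intro exI[of _ "\<lambda>t. \<Delta>F t - Q t / 2"] exI[of _ Q]) (auto simp: \<Delta>F_def)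
qed

end
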